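(* Let $d\ge2$, let $h$ be a needlet filter, and define the filter $H$ by $H(t)=1$ for $0\le t<1$ and $H(t)=h(t)^2$ for $t\ge1$. Let $\psi_{jk}$ be the needlets with filter $h$ and given needlet quadrature rules, and let $\mathcal{Q}_N=\{(W_i,\mathbf{y}_i):i=1,\dots,N\}$ be a positive quadrature rule on $\mathbb{S}^d$ (exact for polynomials of degree up to some $\nu\ge0$). Then for every $f\in C(\mathbb{S}^d)$ and every integer $J\ge0$, $$V_{2^{J-1},H,N}(f)=\sum_{j=0}^{J}\sum_{k=1}^{N_j}(f,\psi_{jk})_{\mathcal{Q}_N}\,\psi_{jk}=V^{\mathrm{need}}_{J,N}(f),$$ that is, the discrete needlet approximation $V^{\mathrm{need}}_{J,N}(f)$ of order $J$ (defined as the middle expression) equals the filtered hyperinterpolation approximation $V_{2^{J-1},H,N}(f)$.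
   Context: $\mathbb{R}_+=[0,\infty)$. $\mathbb{S}^d\subset\mathbb{R}^{d+1}$ is the unit sphere with normalised surface measure $\sigma_d$ ($\sigma_d(\mathbb{S}^d)=1$). "Polynomial of degree up to $\nu$" means the restriction to $\mathbb{S}^d$ of a polynomial on $\mathbb{R}^{d+1}$ of total degree at most $\nu$. $Z(d,\ell)=(2\ell+d-1)\frac{\Gamma(\ell+d-1)}{\Gamma(d)\Gamma(\ell+1)}$ is the dimension of the space of spherical harmonics of exact degree $\ell$, and $P_\ell^{(d+1)}(t)=P_\ell^{(\frac{d-2}{2},\frac{d-2}{2})}(t)/P_\ell^{(\frac{d-2}{2},\frac{d-2}{2})}(1)$ is the normalised Gegenbauer polynomial, with $P_\ell^{(\alpha,\beta)}$ the Jacobi polynomial. Positive quadrature rule: a finite set $\{(w_k,\mathbf{x}_k)\}_{k=1}^{N}$ with $w_k>0$, $\mathbf{x}_k\in\mathbb{S}^d$; it is exact for polynomials of degree up to $\nu$ if $\int_{\mathbb{S}^d}q\,d\sigma_d=\sum_k w_k q(\mathbf{x}_k)$ for all such $q$. Discrete inner product: $(f,g)_{\mathcal{Q}_N}:=\sum_{i=1}^N W_i f(\mathbf{y}_i)g(\mathbf{y}_i)$ for $f,g\in C(\mathbb{S}^d)$. Needlet filter: $h:\mathbb{R}_+\to\mathbb{R}_+$ with $h\in C^\kappa(\mathbb{R}_+)$ for some integer $\kappa\ge1$, $\operatorname{supp}h=[1/2,2]$, and $h(t)^2+h(2t)^2=1$ for $t\in[1/2,1]$. Filtered kernel with filter $g$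 (continuous, $\mathbb{R}_+\to\mathbb{R}_+$, support in $[0,2]$): $v_{T,g}(\mathbf{x}\cdot\mathbf{y})=1$ if $0\le T<1$, and $v_{T,g}(\mathbf{x}\cdot\mathbf{y})=\sum_{\ell=0}^\infty g(\ell/T)Z(d,\ell)P_\ell^{(d+1)}(\mathbf{x}\cdot\mathbf{y})$ if $T\ge1$. Needlets: for each $j\ge0$, the needlet quadrature $\{(w_{jk},\mathbf{x}_{jk}):k=1,\dots,N_j\}$ is a positive quadrature rule exact for polynomials of degree up to $2^{j+1}-1$, and $\psi_{jk}(\mathbf{x}):=\sqrt{w_{jk}}\,v_{2^{j-1},h}(\mathbf{x}\cdot\mathbf{x}_{jk})$. Filtered hyperinterpolation: $V_{T,g,N}(f;\mathbf{x}):=\sum_{i=1}^N W_i f(\mathbf{y}_i)\,v_{T,g}(\mathbf{y}_i\cdot\mathbf{x})$ for $f\in C(\mathbb{S}^d)$, $T\in\mathbb{R}_+$. *)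

theory Defs
  imports "HOL-Analysis.Analysis"
begin

section \<open>The sphere, its normalised surface measure, and polynomials\<close>

text \<open>
  Surface measure is the angular part of Lebesgue measure in polar coordinates: the measure of a
  Borel set \<open>A\<close> on the sphere is proportional to the volume of the cone
  \<open>{r x | x \<in> A, 0 < r < 1}\<close>, and dividing by the volume of the unit ball gives total mass 1.
  The origin, which \<open>sgn x = x /\<^sub>R norm x\<close> sends to 0 and not to the sphere, is a null set.
\<close>

definition sphere_measure :: "(real ^ 'n) measure"  (\<open>\<sigma>\<^sub>S\<close>) where
  "sphere_measure =
     restrict_space (distr (uniform_measure lborel (ball 0 1)) borel sgn) (sphere 0 1)"

lemma measurable_sgn_borel [measurable]: "sgn \<in> borel \<rightarrow>\<^sub>M (borel :: (real ^ 'n) measure)"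
  unfolding sgn_div_norm by measurable

text \<open>The cone formula, the total mass, and rotation invariance; the sort \<open>wellorder\<close> in the last
  lemma comes from \<open>measure_orthogonal_image\<close>.\<close>

lemma emeasure_sphere_measure:
  fixes A :: "(real ^ 'n) set"
  assumes "A \<in> sets borel" "A \<subseteq> sphere 0 1"
  shows "emeasure \<sigma>\<^sub>S A
           = emeasure lborel {x \<in> ball 0 1. sgn x \<in> A} / emeasure lborel (ball (0 :: real ^ 'n) 1)"
proof -
  have m: "sgn -` A \<in> sets (lborel :: (real ^ 'n) measure)"
    using measurable_sets[OF measurable_sgn_borel assms(1)] by simp
  have eq: "ball 0 1 \<inter> sgn -` A = {x \<in> ball 0 1. sgn x \<in> A}"
    by auto
  have "emeasure \<sigma>\<^sub>S A
          = emeasure (distr (uniform_measure lborel (ball (0 :: real ^ 'n) 1)) borel sgn) A"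
    unfolding sphere_measure_def using assms(2) by (intro emeasure_restrict_space) auto
  also have "\<dots> = emeasure (uniform_measure lborel (ball (0 :: real ^ 'n) 1)) (sgn -` A)"
    using assms(1) measurable_sgn_borel
    by (subst emeasure_distr)
       (auto simp: measurable_cong_sets[OF trans[OF sets_uniform_measure sets_lborel] refl])
  also have "\<dots> = emeasure lborel (ball 0 1 \<inter> sgn -` A) / emeasure lborel (ball (0 :: real ^ 'n) 1)"
    using m by (intro emeasure_uniform_measure) auto
  finally show ?thesis
    by (simp only: eq)
qed

lemma emeasure_sphere_measure_sphere: "emeasure \<sigma>\<^sub>S (sphere (0 :: real ^ 'n) 1) = 1"
proof -
  let ?B = "ball (0 :: real ^ 'n) 1"
  have "{x \<in> ?B. sgn x \<in> sphere 0 1} = ?B - {0}"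
    by (auto simp: norm_sgn)
  moreover have "emeasure lborel (?B - {0}) = emeasure lborel ?B"
    by (rule emeasure_Diff_null_set) auto
  moreover have "emeasure lborel ?B \<noteq> \<infinity>"
    using emeasure_bounded_finite[of ?B] by auto
  moreover have "emeasure lborel ?B \<noteq> 0"
  proof
    assume "emeasure lborel ?B = 0"
    then have "?B \<in> null_sets lborel"
      by (simp add: null_sets_def)
    then have "negligible ?B"
      using negligible_iff_null_sets null_sets_completionI by blast
    then show False
      using open_not_negligible[of ?B] by auto
  qed
  ultimately show ?thesis
    by (subst emeasure_sphere_measure) (auto intro!: ennreal_divide_self simp: top.not_eq_extremum)
qed

lemma emeasure_sphere_measure_rotate:
  fixes g :: "real ^ 'n::{finite,wellorder} \<Rightarrow> real ^ 'n::{finite,wellorder}"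
  assumes g: "orthogonal_transformation g" and A: "A \<in> sets borel" "A \<subseteq> sphere 0 1"
  shows "emeasure \<sigma>\<^sub>S (g ` A) = emeasure \<sigma>\<^sub>S A"
proof -
  have lin: "linear g" and nrm: "norm (g x) = norm x" for x
    using g by (auto simp: orthogonal_transformation)
  have bij: "bij g"
    using orthogonal_transformation_bij[OF g] .
  let ?C = "\<lambda>A. {x \<in> ball 0 1. sgn x \<in> A} :: (real ^ 'n::{finite,wellorder}) set"
  have sg: "sgn (g x) = g (sgn x)" for x
    by (simp add: sgn_div_norm nrm linear_scale[OF lin])
  have C: "?C (g ` A) = g ` ?C A"
  proof (intro set_eqI iffI)
    fix x assume "x \<in> ?C (g ` A)"
    moreover obtain z where "x = g z"
      using bij by (metis bij_pointE)
    ultimately show "x \<in> g ` ?C A"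
      using bij by (auto simp: sg nrm bij_is_inj inj_image_mem_iff)
  qed (auto simp: sg nrm)
  have mC: "?C B \<in> sets borel" if "B \<in> sets borel" for B
  proof -
    have "sgn -` B \<in> sets (borel :: (real ^ 'n::{finite,wellorder}) measure)"
      using measurable_sets[OF measurable_sgn_borel that] by simp
    moreover have "?C B = ball 0 1 \<inter> sgn -` B"
      by auto
    ultimately show ?thesis
      by auto
  qed
  have "homeomorphism UNIV UNIV g (inv g)"
  proof -
    have "linear (inv g)"
      using bij lin by (simp add: bij_is_inj bij_is_surj inj_linear_imp_inv_linear)
    then show ?thesis
      using bij lin
      by (auto simp: homeomorphism_def linear_continuous_on linear_conv_bounded_linear
                     bij_is_inj bij_is_surj surj_f_inv_f bij_imp_bij_inv)
  qed
  then have cinv: "inv g \<in> borel_measurable borel"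
    by (auto simp: homeomorphism_def intro: borel_measurable_continuous_onI)
  have gA: "g ` A \<in> sets borel"
    using measurable_sets[OF cinv A(1)] bij by (simp add: bij_vimage_eq_inv_image bij_imp_bij_inv inv_inv_eq)
  have fin: "?C A \<in> lmeasurable"
    using mC[OF A(1)] by (intro bounded_set_imp_lmeasurable bounded_subset[OF bounded_ball[of 0 1]]) auto
  have fin': "?C (g ` A) \<in> lmeasurable"
    using mC[OF gA] by (intro bounded_set_imp_lmeasurable bounded_subset[OF bounded_ball[of 0 1]]) auto
  have "emeasure lborel (?C (g ` A)) = emeasure lebesgue (?C (g ` A))"
    using mC[OF gA] by simp
  also have "\<dots> = emeasure lebesgue (?C A)"
    unfolding emeasure_eq_measure2[OF fin] emeasure_eq_measure2[OF fin']
    using measure_orthogonal_image[OF g fin] by (simp only: C)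
  also have "\<dots> = emeasure lborel (?C A)"
    using mC[OF A(1)] by simp
  finally show ?thesis
    using A gA by (subst (1 2) emeasure_sphere_measure) (auto simp: nrm)
qed

definition poly_degree_le :: "nat \<Rightarrow> (real ^ 'n \<Rightarrow> real) \<Rightarrow> bool" where
  "poly_degree_le \<nu> q \<longleftrightarrow>
     (\<exists>c :: ('n \<Rightarrow> nat) \<Rightarrow> real. \<forall>x. q x =
        (\<Sum>a | (\<Sum>i\<in>UNIV. a i) \<le> \<nu>. c a * (\<Prod>i\<in>UNIV. (x $ i) ^ a i)))"

lemma finite_multi_indices: "finite {a :: 'n::finite \<Rightarrow> nat. (\<Sum>i\<in>UNIV. a i) \<le> \<nu>}"
proof (rule finite_subset)
  show "{a :: 'n \<Rightarrow> nat. (\<Sum>i\<in>UNIV. a i) \<le> \<nu>} \<subseteq> PiE UNIV (\<lambda>_. {..\<nu>})"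
  proof
    fix a :: "'n \<Rightarrow> nat"
    assume a: "a \<in> {a. (\<Sum>i\<in>UNIV. a i) \<le> \<nu>}"
    have "a i \<le> (\<Sum>i\<in>UNIV. a i)" for i
      by (rule member_le_sum) auto
    with a show "a \<in> PiE UNIV (\<lambda>_. {..\<nu>})"
      by (auto intro: order_trans)
  qed
qed (auto intro: finite_PiE)


section \<open>Zonal kernels\<close>

definition Zdim :: "nat \<Rightarrow> nat \<Rightarrow> real" where
  "Zdim d l = (2 * real l + real d - 1) * Gamma (real l + real d - 1)
                / (Gamma (real d) * Gamma (real l + 1))"

text \<open>Szego's normalisation: the value at 1 is \<open>(n + \<alpha>) gchoose n\<close>.\<close>

definition jacobi_P :: "nat \<Rightarrow> real \<Rightarrow> real \<Rightarrow> real \<Rightarrow> real" where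
  "jacobi_P n \<alpha> \<beta> t =
     (\<Sum>s\<le>n. ((real n + \<alpha>) gchoose s) * ((real n + \<beta>) gchoose (n - s))
              * ((t - 1) / 2) ^ (n - s) * ((t + 1) / 2) ^ s)"

text \<open>The dimension parameter is the \<open>d\<close> of the sphere \<open>S\<^sup>d\<close> in \<open>d + 1\<close> dimensional space.\<close>

definition gegenbauer_P :: "nat \<Rightarrow> nat \<Rightarrow> real \<Rightarrow> real" where
  "gegenbauer_P d l t =
     jacobi_P l ((real d - 2) / 2) ((real d - 2) / 2) t
       / jacobi_P l ((real d - 2) / 2) ((real d - 2) / 2) 1"

text \<open>For a filter supported in \<open>[0, 2]\<close> only the terms with \<open>l \<le> 2 T\<close> of the series are nonzero.\<close>

definition filtered_kernel :: "nat \<Rightarrow> real \<Rightarrow> (real \<Rightarrow> real) \<Rightarrow> real \<Rightarrow> real" where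
  "filtered_kernel d T g t =
     (if T < 1 then 1
      else (\<Sum>l. g (real l / T) * Zdim d l * gegenbauer_P d l t))"


section \<open>Filters\<close>

text \<open>Derivatives are taken within \<open>S\<close>, hence one-sided at an endpoint of an interval.\<close>

primrec C_k_on :: "nat \<Rightarrow> (real \<Rightarrow> real) \<Rightarrow> real set \<Rightarrow> bool" where
  "C_k_on 0 f S \<longleftrightarrow> continuous_on S f"
| "C_k_on (Suc k) f S \<longleftrightarrow>
     (\<exists>f'. (\<forall>t\<in>S. (f has_real_derivative f' t) (at t within S)) \<and> C_k_on k f' S)"

text \<open>Functions on the nonnegative reals are total functions whose values at negative arguments
  are irrelevant.\<close>

definition needlet_filter :: "(real \<Rightarrow> real) \<Rightarrow> bool" where
  "needlet_filter h \<longleftrightarrow>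
     (\<forall>t\<ge>0. h t \<ge> 0) \<and>
     (\<exists>\<kappa>\<ge>1. C_k_on \<kappa> h {0..}) \<and>
     closure {t. t \<ge> 0 \<and> h t \<noteq> 0} = {1/2..2} \<and>
     (\<forall>t\<in>{1/2..1}. (h t)\<^sup>2 + (h (2 * t))\<^sup>2 = 1)"

definition hyper_filter :: "(real \<Rightarrow> real) \<Rightarrow> real \<Rightarrow> real" where
  "hyper_filter h t = (if t < 1 then 1 else (h t)\<^sup>2)"


section \<open>Quadrature rules, needlets and the two approximations\<close>

text \<open>A rule with \<open>N\<close> nodes is given by its weights and nodes at the indices \<open>1, \<dots>, N\<close>.\<close>

definition positive_quadrature ::
    "nat \<Rightarrow> (nat \<Rightarrow> real) \<Rightarrow> (nat \<Rightarrow> real ^ 'n) \<Rightarrow> bool" where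
  "positive_quadrature N w x \<longleftrightarrow> (\<forall>k\<in>{1..N}. w k > 0 \<and> x k \<in> sphere 0 1)"

definition quadrature_exact ::
    "nat \<Rightarrow> nat \<Rightarrow> (nat \<Rightarrow> real) \<Rightarrow> (nat \<Rightarrow> real ^ 'n) \<Rightarrow> bool" where
  "quadrature_exact \<nu> N w x \<longleftrightarrow>
     (\<forall>q. poly_degree_le \<nu> q \<longrightarrow> (\<integral>z. q z \<partial>\<sigma>\<^sub>S) = (\<Sum>k=1..N. w k * q (x k)))"

definition discrete_inner ::
    "nat \<Rightarrow> (nat \<Rightarrow> real) \<Rightarrow> (nat \<Rightarrow> real ^ 'n)
      \<Rightarrow> (real ^ 'n \<Rightarrow> real) \<Rightarrow> (real ^ 'n \<Rightarrow> real) \<Rightarrow> real" where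
  "discrete_inner N W y f g = (\<Sum>i=1..N. W i * f (y i) * g (y i))"

text \<open>\<open>w j k\<close> and \<open>xi j k\<close> are the weights and nodes of the level \<open>j\<close> needlet quadrature.\<close>

definition needlet ::
    "nat \<Rightarrow> (real \<Rightarrow> real) \<Rightarrow> (nat \<Rightarrow> nat \<Rightarrow> real) \<Rightarrow> (nat \<Rightarrow> nat \<Rightarrow> real ^ 'n)
      \<Rightarrow> nat \<Rightarrow> nat \<Rightarrow> real ^ 'n \<Rightarrow> real" where
  "needlet d h w xi j k x =
     sqrt (w j k) * filtered_kernel d (2 powr (real j - 1)) h (x \<bullet> xi j k)"

definition filtered_hyperinterpolation ::
    "nat \<Rightarrow> real \<Rightarrow> (real \<Rightarrow> real) \<Rightarrow> nat \<Rightarrow> (nat \<Rightarrow> real) \<Rightarrow> (nat \<Rightarrow> real ^ 'n)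
      \<Rightarrow> (real ^ 'n \<Rightarrow> real) \<Rightarrow> real ^ 'n \<Rightarrow> real" where
  "filtered_hyperinterpolation d T g N W y f x =
     (\<Sum>i=1..N. W i * f (y i) * filtered_kernel d T g (y i \<bullet> x))"

definition discrete_needlet_approx ::
    "nat \<Rightarrow> (real \<Rightarrow> real)
      \<Rightarrow> (nat \<Rightarrow> nat) \<Rightarrow> (nat \<Rightarrow> nat \<Rightarrow> real) \<Rightarrow> (nat \<Rightarrow> nat \<Rightarrow> real ^ 'n)
      \<Rightarrow> nat \<Rightarrow> nat \<Rightarrow> (nat \<Rightarrow> real) \<Rightarrow> (nat \<Rightarrow> real ^ 'n)
      \<Rightarrow> (real ^ 'n \<Rightarrow> real) \<Rightarrow> real ^ 'n \<Rightarrow> real" where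
  "discrete_needlet_approx d h Nn w xi J N W y f x =
     (\<Sum>j=0..J. \<Sum>k=1..Nn j.
        discrete_inner N W y f (needlet d h w xi j k) * needlet d h w xi j k x)"

end

theory Submission
  imports Defs "HOL-Computational_Algebra.Polynomial"
begin

text \<open>
  Write \<open>P\<^sub>l\<close> for the Gegenbauer polynomials normalised by \<open>P\<^sub>l(1) = 1\<close>. The theorem rests on the
  reproducing property \<open>\<integral> P\<^sub>l(x \<bullet> z) P\<^sub>m(y \<bullet> z) d\<sigma>(z) = \<delta>\<^sub>l\<^sub>m P\<^sub>l(x \<bullet> y) / Z(d, l)\<close>: the product of two needlets of level
  \<open>j\<close>, as a function of the node, is a polynomial of degree at most \<open>2 ^ (j + 1) - 2\<close>, so the quadrature
  sum over the nodes equals the integral, and the filters \<open>h(l / 2 ^ (j - 1))\<^sup>2\<close> add up to \<open>H\<close>.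

  The reproducing property follows from a single integration by parts on the sphere. With
  \<open>D p = (1 - t\<^sup>2) p'' - d t p'\<close>, \<open>s = x \<bullet> z\<close>, \<open>t = y \<bullet> z\<close>, it reads
  \<open>\<integral> (D p)(s) q(t) d\<sigma> = \<integral> s p'(s) t q'(t) d\<sigma> - (x \<bullet> y) \<integral> p'(s) q'(t) d\<sigma>\<close>.
  Its symmetry in \<open>p\<close> and \<open>q\<close> gives the orthogonality, as \<open>P\<^sub>l\<close> is an eigenfunction of \<open>D\<close>. Taking for
  \<open>p = q\<close> an antiderivative of \<open>P\<^sub>l\<close>, it expresses \<open>(x \<bullet> y) E\<^sub>l\<close> through \<open>E\<^sub>l\<^sub>+\<^sub>1\<close> and \<open>E\<^sub>l\<^sub>-\<^sub>1\<close>, where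
  \<open>E\<^sub>l = \<integral> P\<^sub>l(s) P\<^sub>l(t) d\<sigma>\<close>; this is the three-term recurrence of \<open>P\<^sub>l(x \<bullet> y) / Z(d, l)\<close>.
\<close>

section \<open>Rotation invariance\<close>

text \<open>
  Uniqueness of translation invariant measures: integrating \<open>1\<^sub>A(g x) 1\<^sub>B(y - g x)\<close> over \<open>x\<close> and \<open>y\<close> in both
  orders, with \<open>B\<close> the unit ball, which \<open>g\<close> preserves.
\<close>

lemma emeasure_lborel_orthogonal_vimage:
  fixes g :: "'a::euclidean_space \<Rightarrow> 'a"
  assumes g: "orthogonal_transformation g" and A: "A \<in> sets borel"
  shows "emeasure lborel (g -` A) = emeasure lborel A"
proof -
  let ?B = "ball (0::'a) 1"
  have lin: "linear g" and nrm: "norm (g x) = norm x" for x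
    using g by (auto simp: orthogonal_transformation)
  have sur: "surj g"
    using g by (simp add: orthogonal_transformation_surj)
  have [measurable]: "g \<in> borel_measurable borel"
    using lin by (intro borel_measurable_continuous_onI linear_continuous_on)
      (simp add: linear_conv_bounded_linear)
  note A [measurable]
  have [measurable]: "ball (0::'a) 1 \<in> sets borel"
    by simp
  let ?F = "\<lambda>x y. indicator A (g x) * indicator ?B (y - g x) :: ennreal"
  \<comment> \<open>Translation invariance of Lebesgue measure, applied below to shift
    \<open>y\<close> by \<open>g x\<close>, \<open>x\<close> by \<open>y'\<close>, and
    \<open>y\<close> once more.\<close>
  have trans: "(\<integral>\<^sup>+ x. F (a + x) \<partial>lborel) = (\<integral>\<^sup>+ x. F x \<partial>lborel)"
    if [measurable]: "F \<in> borel_measurable borel" for F and a :: 'a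
    by (subst (2) lborel_distr_plus[symmetric, where c = a]) (simp add: nn_integral_distr)
  have "(\<integral>\<^sup>+ x. \<integral>\<^sup>+ y. ?F x y \<partial>lborel \<partial>lborel) = (\<integral>\<^sup>+ x. indicator A (g x) * emeasure lborel ?B \<partial>lborel)"
  proof (rule nn_integral_cong)
    fix x
    have "(\<integral>\<^sup>+ y. ?F x y \<partial>lborel) = (\<integral>\<^sup>+ y. ?F x (g x + y) \<partial>lborel)"
      by (rule trans[symmetric]) measurable
    also have "\<dots> = indicator A (g x) * emeasure lborel ?B"
      by (simp add: nn_integral_cmult)
    finally show "(\<integral>\<^sup>+ y. ?F x y \<partial>lborel) = indicator A (g x) * emeasure lborel ?B" .
  qed
  also have "\<dots> = (\<integral>\<^sup>+ x. indicator (g -` A) x \<partial>lborel) * emeasure lborel ?B"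
    by (simp add: nn_integral_multc indicator_def)
  also have "(\<integral>\<^sup>+ x. indicator (g -` A) x \<partial>lborel) = emeasure lborel (g -` A)"
    using measurable_sets[of g borel borel A] A by (intro nn_integral_indicator) simp
  finally have 1: "(\<integral>\<^sup>+ x. \<integral>\<^sup>+ y. ?F x y \<partial>lborel \<partial>lborel)
      = emeasure lborel (g -` A) * emeasure lborel ?B" .
  have "(\<integral>\<^sup>+ x. \<integral>\<^sup>+ y. ?F x y \<partial>lborel \<partial>lborel) = (\<integral>\<^sup>+ y. \<integral>\<^sup>+ x. ?F x y \<partial>lborel \<partial>lborel)"
    by (rule lborel_pair.Fubini') measurable
  also have "\<dots> = (\<integral>\<^sup>+ y. \<integral>\<^sup>+ x. indicator A (y + g x) * indicator ?B x \<partial>lborel \<partial>lborel)"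
  proof (rule nn_integral_cong)
    fix y
    \<comment> \<open>Surjectivity of \<open>g\<close> lets a translation of \<open>x\<close> by
      \<open>y'\<close> turn \<open>y - g x\<close> into \<open>- g x\<close>, which lies in the
      ball exactly when \<open>x\<close> does.\<close>
    obtain y' where y': "y = g y'"
      using sur by (metis surjD)
    have "(\<integral>\<^sup>+ x. ?F x y \<partial>lborel) = (\<integral>\<^sup>+ x. ?F (y' + x) y \<partial>lborel)"
      by (rule trans[symmetric]) measurable
    also have "\<dots> = (\<integral>\<^sup>+ x. indicator A (y + g x) * indicator ?B x \<partial>lborel)"
      by (intro nn_integral_cong) (simp add: y' linear_add[OF lin] indicator_def nrm)
    finally show "(\<integral>\<^sup>+ x. ?F x y \<partial>lborel) = (\<integral>\<^sup>+ x. indicator A (y + g x) * indicator ?B x \<partial>lborel)" .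
  qed
  also have "\<dots> = (\<integral>\<^sup>+ x. \<integral>\<^sup>+ y. indicator A (y + g x) * indicator ?B x \<partial>lborel \<partial>lborel)"
    by (rule lborel_pair.Fubini') measurable
  also have "\<dots> = (\<integral>\<^sup>+ x. emeasure lborel A * indicator ?B x \<partial>lborel)"
  proof (rule nn_integral_cong)
    fix x
    have "(\<integral>\<^sup>+ y. indicator A (g x + y) \<partial>lborel) = (\<integral>\<^sup>+ y. indicator A y \<partial>lborel :: ennreal)"
      by (rule trans) measurable
    then show "(\<integral>\<^sup>+ y. indicator A (y + g x) * indicator ?B x \<partial>lborel)
        = emeasure lborel A * indicator ?B x"
      using A by (simp add: nn_integral_multc add.commute)
  qed
  also have "\<dots> = emeasure lborel A * emeasure lborel ?B"
    by (simp add: nn_integral_cmult)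
  finally have eq: "emeasure lborel (g -` A) * emeasure lborel ?B = emeasure lborel A * emeasure lborel ?B"
    using 1 by simp
  have "emeasure lborel ?B \<noteq> \<infinity>"
    using emeasure_bounded_finite[of ?B] by auto
  moreover have "emeasure lborel ?B \<noteq> 0"
    using open_not_negligible[of ?B]
    by (auto simp: negligible_iff_null_sets null_sets_def)
  ultimately show ?thesis
    using eq by (metis ennreal_mult_divide_eq infinity_ennreal_def)
qed

section \<open>Integrals with respect to the sphere measure\<close>

lemma borel_measurable_sphere_measure:
  fixes F :: "real ^ 'n \<Rightarrow> real"
  assumes "F \<in> borel_measurable borel"
  shows "F \<in> borel_measurable \<sigma>\<^sub>S"
  using assms unfolding sphere_measure_def
  by (intro measurable_restrict_space1) simp

lemma space_sphere_measure [simp]: "space \<sigma>\<^sub>S = sphere (0 :: real ^ 'n) 1"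
  by (simp add: sphere_measure_def space_restrict_space)

lemma finite_measure_sphere_measure: "finite_measure (\<sigma>\<^sub>S :: (real ^ 'n) measure)"
  by (rule finite_measureI) (simp add: emeasure_sphere_measure_sphere)

text \<open>Unfolds the restriction and the push-forward. The indicator remains because
  \<open>sgn\<close> sends the origin to 0, off the sphere.\<close>

lemma integral_sphere_measure:
  fixes F :: "real ^ 'n \<Rightarrow> real"
  assumes [measurable]: "F \<in> borel_measurable borel"
  shows "(\<integral>z. F z \<partial>\<sigma>\<^sub>S) = (\<integral>x. indicator (sphere 0 1) (sgn x) * F (sgn x)
           \<partial>uniform_measure lborel (ball 0 1))"
proof -
  have [measurable]: "sphere (0 :: real ^ 'n) 1 \<in> sets borel"
    by simp
  show ?thesis
    unfolding sphere_measure_def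
    by (subst integral_restrict_space, simp, subst integral_distr)
      (simp_all add: measurable_cong_sets[OF trans[OF sets_uniform_measure sets_lborel] refl])
qed

text \<open>An orthogonal map commutes with \<open>sgn\<close> and preserves both Lebesgue measure
  and the unit ball, hence the uniform measure on the ball, whose image under \<open>sgn\<close>
  defines the sphere measure.\<close>

lemma integral_sphere_measure_orthogonal:
  fixes F :: "real ^ 'n \<Rightarrow> real" and g :: "real ^ 'n \<Rightarrow> real ^ 'n"
  assumes g: "orthogonal_transformation g" and F [measurable]: "F \<in> borel_measurable borel"
  shows "(\<integral>z. F (g z) \<partial>\<sigma>\<^sub>S) = (\<integral>z. F z \<partial>\<sigma>\<^sub>S)"
proof -
  let ?U = "uniform_measure lborel (ball (0 :: real ^ 'n) 1)"
  have lin: "linear g" and nrm: "norm (g x) = norm x" for x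
    using g by (auto simp: orthogonal_transformation)
  have [measurable]: "g \<in> borel_measurable borel"
    using lin by (intro borel_measurable_continuous_onI linear_continuous_on)
      (simp add: linear_conv_bounded_linear)
  have [measurable_cong]: "sets ?U = sets borel"
    by simp
  have sg: "g (sgn x) = sgn (g x)" for x
    by (simp add: sgn_div_norm nrm linear_scale[OF lin])
  have inv: "distr ?U borel g = ?U"
  proof (rule measure_eqI)
    fix A assume "A \<in> sets (distr ?U borel g)"
    then have A [measurable]: "A \<in> sets borel"
      by simp
    have gA: "g -` A \<in> sets borel"
      using measurable_sets[of g borel borel A] by simp
    have "ball 0 1 \<inter> g -` A = g -` (ball 0 1 \<inter> A)"
      by (auto simp: nrm)
    then have "emeasure lborel (ball 0 1 \<inter> g -` A) = emeasure lborel (ball 0 1 \<inter> A)"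
      using emeasure_lborel_orthogonal_vimage[OF g, of "ball 0 1 \<inter> A"] by simp
    then show "emeasure (distr ?U borel g) A = emeasure ?U A"
      using gA by (simp add: emeasure_distr)
  qed simp
  have "(\<integral>z. F (g z) \<partial>\<sigma>\<^sub>S) = (\<integral>x. indicator (sphere 0 1) (sgn (g x)) * F (sgn (g x)) \<partial>?U)"
  proof (subst integral_sphere_measure)
    have "g x = 0 \<longleftrightarrow> x = 0" for x
      by (metis nrm norm_eq_zero)
    then show "(\<integral>x. indicator (sphere 0 1) (sgn x) * F (g (sgn x)) \<partial>?U)
        = (\<integral>x. indicator (sphere 0 1) (sgn (g x)) * F (sgn (g x)) \<partial>?U)"
      by (intro Bochner_Integration.integral_cong) (auto simp: sg norm_sgn indicator_def)
  qed measurable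
  also have "\<dots> = (\<integral>x. indicator (sphere 0 1) (sgn x) * F (sgn x) \<partial>distr ?U borel g)"
    using measurable_compose[OF measurable_sgn_borel F]
      measurable_sets[OF measurable_sgn_borel, of "sphere 0 1"]
    by (intro integral_distr[symmetric])
      (auto intro!: borel_measurable_times borel_measurable_indicator' simp: vimage_def)
  finally show ?thesis
    by (simp add: inv integral_sphere_measure)
qed

section \<open>Gegenbauer polynomials\<close>

text \<open>
  Defined through the raising operator of the Gegenbauer equation, so that the equation passes from
  \<open>l\<close> to \<open>l + 1\<close>; \<open>gegenbauer_P_eq_geg\<close> identifies these with the normalised Jacobi polynomials.
\<close>

primrec geg :: "nat \<Rightarrow> nat \<Rightarrow> real poly" where
  "geg d 0 = 1"
| "geg d (Suc l) = [:0, 1:] * geg d l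
     - smult (1 / (real l + real d - 1)) ([:1, 0, -1:] * pderiv (geg d l))"

section \<open>Gegenbauer equation, ladder relations and three-term recurrence\<close>

lemma poly_geg_Suc: "poly (geg d (Suc l)) t
    = t * poly (geg d l) t - (1 - t\<^sup>2) * poly (pderiv (geg d l)) t / (real l + real d - 1)"
  by (simp add: power2_eq_square left_diff_distrib diff_divide_distrib add_divide_distrib mult.assoc)

text \<open>The Laplace-Beltrami operator of the unit sphere of dimension \<open>d\<close>, acting
  on zonal functions. The parameter is real so that it can also be \<open>2 * \<alpha> + 2\<close>
  in the Jacobi equation.\<close>

definition geg_op :: "real \<Rightarrow> real poly \<Rightarrow> real poly" where
  "geg_op d p = [:1, 0, -1:] * pderiv (pderiv p) - smult d ([:0, 1:] * pderiv p)"

lemma poly_geg_op: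
  "poly (geg_op d p) t = (1 - t\<^sup>2) * poly (pderiv (pderiv p)) t - d * t * poly (pderiv p) t"
  by (simp add: geg_op_def power2_eq_square algebra_simps)

lemma geg_op_add: "geg_op d (p + q) = geg_op d p + geg_op d q"
  by (rule poly_ext) (simp add: poly_geg_op pderiv_add algebra_simps)

lemma geg_op_smult: "geg_op d (smult c p) = smult c (geg_op d p)"
  by (rule poly_ext) (simp add: poly_geg_op pderiv_smult algebra_simps)

text \<open>Differentiating the raising formula brings in the second derivative, which the equation
  for \<open>l\<close> eliminates. The equation is a hypothesis because this lemma serves the
  induction that proves it.\<close>

lemma pderiv_geg_Suc_aux:
  assumes d: "d \<ge> 2"
    and ode: "geg_op (real d) (geg d l) = smult (- (real l * (real l + real d - 1))) (geg d l)"
  shows "pderiv (geg d (Suc l)) = smult (real l + 1)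
      (geg d l + smult (1 / (real l + real d - 1)) ([:0, 1:] * pderiv (geg d l)))"
proof (rule poly_ext)
  fix t
  define c where "c = real l + real d - 1"
  have c: "c > 0"
    using d by (simp add: c_def)
  let ?p = "poly (geg d l) t" and ?p1 = "poly (pderiv (geg d l)) t"
    and ?p2 = "poly (pderiv (pderiv (geg d l))) t"
  have o: "(1 - t\<^sup>2) * ?p2 = real d * t * ?p1 - real l * c * ?p"
    using arg_cong[OF ode, where f = "\<lambda>p. poly p t"] by (simp add: poly_geg_op c_def)
  have "poly (pderiv (geg d (Suc l))) t = ?p + t * ?p1 - 1 / c * ((1 - t\<^sup>2) * ?p2 - 2 * t * ?p1)"
    by (simp add: pderiv_add pderiv_diff pderiv_minus pderiv_smult pderiv_pCons c_def[symmetric]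
        power2_eq_square) (simp add: algebra_simps diff_divide_distrib add_divide_distrib)
  also have "\<dots> = (real l + 1) * (?p + t * ?p1 / c)"
    unfolding o using c by (simp add: field_simps) (simp add: c_def algebra_simps)
  finally show "poly (pderiv (geg d (Suc l))) t = poly (smult (real l + 1)
      (geg d l + smult (1 / (real l + real d - 1)) ([:0, 1:] * pderiv (geg d l)))) t"
    by (simp add: c_def algebra_simps)
qed

text \<open>The formula for the first derivative of the next polynomial contains no second
  derivative of \<open>geg d l\<close>. Differentiated once more it contains one, which the operator
  multiplies by 1 - t^2, so that the equation for \<open>l\<close> removes it.\<close>

lemma geg_op_geg:
  assumes d: "d \<ge> 2"
  shows "geg_op (real d) (geg d l) = smult (- (real l * (real l + real d - 1))) (geg d l)"
proof (induction l)
  case 0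
  show ?case
    by (simp add: geg_op_def)
next
  case (Suc l)
  show ?case
  proof (rule poly_ext)
    fix t
    define c where "c = real l + real d - 1"
    have c: "c > 0"
      using d by (simp add: c_def)
    let ?p = "poly (geg d l) t" and ?p1 = "poly (pderiv (geg d l)) t"
      and ?p2 = "poly (pderiv (pderiv (geg d l))) t"
    have o: "(1 - t\<^sup>2) * ?p2 = real d * t * ?p1 - real l * c * ?p"
      using arg_cong[OF Suc, where f = "\<lambda>p. poly p t"] by (simp add: poly_geg_op c_def)
    have d1: "poly (pderiv (geg d (Suc l))) t = (real l + 1) * (?p + t * ?p1 / c)"
      unfolding pderiv_geg_Suc_aux[OF d Suc] c_def by simp
    have d2: "poly (pderiv (pderiv (geg d (Suc l)))) t = (real l + 1) * (?p1 + ?p1 / c + t * ?p2 / c)"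
      unfolding pderiv_geg_Suc_aux[OF d Suc] c_def[symmetric]
      by (simp add: pderiv_add pderiv_smult pderiv_pCons add_divide_distrib)
    have "poly (geg_op (real d) (geg d (Suc l))) t
        = (real l + 1) / c * ((1 - t\<^sup>2) * (c + 1) * ?p1 + t * ((1 - t\<^sup>2) * ?p2) - real d * t * (c * ?p + t * ?p1))"
      unfolding poly_geg_op d1 d2 using c by (simp add: field_simps)
    also have "\<dots> = - ((real l + 1) * (c + 1)) * (t * ?p - (1 - t\<^sup>2) * ?p1 / c)"
      unfolding o using c by (simp add: field_simps) (simp add: c_def algebra_simps power2_eq_square)
    also have "t * ?p - (1 - t\<^sup>2) * ?p1 / c = poly (geg d (Suc l)) t"
      by (simp add: c_def algebra_simps power2_eq_square diff_divide_distrib)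
    finally show "poly (geg_op (real d) (geg d (Suc l))) t
        = poly (smult (- (real (Suc l) * (real (Suc l) + real d - 1))) (geg d (Suc l))) t"
      by (simp add: c_def add.commute)
  qed
qed

lemma pderiv_geg_Suc:
  assumes "d \<ge> 2"
  shows "pderiv (geg d (Suc l)) = smult (real l + 1)
      (geg d l + smult (1 / (real l + real d - 1)) ([:0, 1:] * pderiv (geg d l)))"
  using pderiv_geg_Suc_aux[OF assms geg_op_geg[OF assms]] .

text \<open>Lowering undoes raising: after inserting the formulas for \<open>geg d (Suc l)\<close>
  and its derivative, the terms with the derivative of \<open>geg d l\<close> cancel and (t^2 + 1 -
  t^2) times \<open>geg d l\<close> remains.\<close>

lemma geg_lower:
  assumes d: "d \<ge> 2"
  shows "geg d l = [:0, 1:] * geg d (Suc l) + smult (1 / (real l + 1)) ([:1, 0, -1:] * pderiv (geg d (Suc l)))"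
proof (rule poly_ext)
  fix t
  define c where "c = real l + real d - 1"
  have "c > 0"
    using d by (simp add: c_def)
  then have "poly (geg d l) t = t * (t * poly (geg d l) t - (1 - t\<^sup>2) * poly (pderiv (geg d l)) t / c)
      + (1 - t\<^sup>2) * (poly (geg d l) t + t * poly (pderiv (geg d l)) t / c)"
    by (simp add: field_simps power2_eq_square)
  then show "poly (geg d l) t
      = poly ([:0, 1:] * geg d (Suc l) + smult (1 / (real l + 1)) ([:1, 0, -1:] * pderiv (geg d (Suc l)))) t"
    unfolding pderiv_geg_Suc[OF d] by (simp add: c_def algebra_simps power2_eq_square diff_divide_distrib)
qed

text \<open>Raising and lowering express both neighbours of degree l + 1 through the polynomial
  itself and 1 - t^2 times its derivative. The weights are those for which the derivative
  cancels.\<close>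

lemma geg_three_term:
  assumes d: "d \<ge> 2"
  shows "smult (2 * real l + real d + 1) ([:0, 1:] * geg d (Suc l))
      = smult (real l + real d) (geg d (Suc (Suc l))) + smult (real l + 1) (geg d l)"
proof (rule poly_ext)
  fix t
  let ?q = "poly (geg d (Suc l)) t" and ?q1 = "poly (pderiv (geg d (Suc l))) t"
  have d': "real l + real d > 0"
    using d by simp
  have 1: "poly (geg d (Suc (Suc l))) t = t * ?q - (1 - t\<^sup>2) * ?q1 / (real l + real d)"
    using poly_geg_Suc[of d "Suc l" t] by (simp add: add.commute del: geg.simps(2))
  have 2: "poly (geg d l) t = t * ?q + (1 - t\<^sup>2) * ?q1 / (real l + 1)"
    using arg_cong[OF geg_lower[OF d, of l], where f = "\<lambda>p. poly p t"]
    by (simp add: power2_eq_square left_diff_distrib add_divide_distrib diff_divide_distrib mult.assoc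
        del: geg.simps(2))
  have "(2 * real l + real d + 1) * (t * ?q)
      = (real l + real d) * poly (geg d (Suc (Suc l))) t + (real l + 1) * poly (geg d l) t"
  proof -
    have "(real l + real d) * poly (geg d (Suc (Suc l))) t = (real l + real d) * (t * ?q) - (1 - t\<^sup>2) * ?q1"
      unfolding 1 using d' by (simp add: right_diff_distrib del: geg.simps(2))
    moreover have "(real l + 1) * poly (geg d l) t = (real l + 1) * (t * ?q) + (1 - t\<^sup>2) * ?q1"
      unfolding 2 by (simp add: distrib_left del: geg.simps(2))
    ultimately show ?thesis
      by (simp add: algebra_simps del: geg.simps(2))
  qed
  then show "poly (smult (2 * real l + real d + 1) ([:0, 1:] * geg d (Suc l))) t
      = poly (smult (real l + real d) (geg d (Suc (Suc l))) + smult (real l + 1) (geg d l)) t"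
    by (simp add: mult.left_commute del: geg.simps(2))
qed

text \<open>Supplies an antiderivative of a multiple of \<open>geg d (Suc l)\<close> that is a
  combination of two eigenfunctions of \<open>geg_op\<close>, as the integration by parts
  requires.\<close>

lemma geg_antiderivative:
  assumes d: "d \<ge> 2"
  shows "smult (2 * real l + real d + 1) (geg d (Suc l))
      = smult ((real l + real d) / (real l + 2)) (pderiv (geg d (Suc (Suc l))))
        - smult ((real l + 1) / (real l + real d - 1)) (pderiv (geg d l))"
proof (rule poly_ext)
  fix t
  define c where "c = real l + real d - 1"
  have c: "c > 0"
    using d by (simp add: c_def)
  let ?p = "poly (geg d l) t" and ?p1 = "poly (pderiv (geg d l)) t"
  let ?q = "poly (geg d (Suc l)) t" and ?q1 = "poly (pderiv (geg d (Suc l))) t"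
  have 1: "poly (pderiv (geg d (Suc (Suc l)))) t = (real l + 2) * (?q + t * ?q1 / (c + 1))"
    by (subst pderiv_geg_Suc[OF d, of "Suc l"]) (simp add: c_def add.commute del: geg.simps(2))
  define r where "r = ?p1 / c"
  have q1: "?q1 = (real l + 1) * (?p + t * r)"
    unfolding pderiv_geg_Suc[OF d, of l] by (simp add: c_def r_def)
  have q: "?q = t * ?p - (1 - t\<^sup>2) * r"
    using poly_geg_Suc[of d l t] by (simp add: c_def r_def)
  have "(c + 1) / (real l + 2) * poly (pderiv (geg d (Suc (Suc l)))) t = (c + 1) * ?q + t * ?q1"
  proof -
    have *: "a / b * (b * (u + v / a)) = a * u + v" if "a > 0" "b > 0" for a b u v :: real
      using that by (simp add: field_simps)
    show ?thesis
      unfolding 1 by (rule *) (use c in auto)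
  qed
  moreover have "(real l + 1) / c * ?p1 = (real l + 1) * r"
    by (simp add: r_def)
  \<comment> \<open>The formulas for \<open>?q\<close> and \<open>?q1\<close> in terms of
    \<open>?p\<close> and \<open>r\<close> give t \<open>?q1\<close> - (l + 1) \<open>r\<close> = (l
    + 1) \<open>?q\<close>.\<close>
  moreover have "(2 * real l + real d + 1) * ?q = (c + 1) * ?q + t * ?q1 - (real l + 1) * r"
    unfolding q1 q by (simp add: c_def algebra_simps power2_eq_square)
  ultimately have "(2 * real l + real d + 1) * ?q
      = (c + 1) / (real l + 2) * poly (pderiv (geg d (Suc (Suc l)))) t - (real l + 1) / c * ?p1"
    by simp
  then show "poly (smult (2 * real l + real d + 1) (geg d (Suc l))) t =
      poly (smult ((real l + real d) / (real l + 2)) (pderiv (geg d (Suc (Suc l))))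
        - smult ((real l + 1) / (real l + real d - 1)) (pderiv (geg d l))) t"
    by (simp add: c_def add.commute del: geg.simps(2))
qed

lemma degree_geg: "degree (geg d l) \<le> l"
proof (induction l)
  case (Suc l)
  have "degree ([:0, 1:] * geg d l) \<le> Suc l"
    using degree_mult_le[of "[:0, 1:]" "geg d l"] Suc by simp
  moreover have "degree ([:1, 0, -1:] * pderiv (geg d l)) \<le> Suc l"
  proof (cases "l = 0")
    case False
    then show ?thesis
      using degree_mult_le[of "[:1, 0, -1:]" "pderiv (geg d l)"] degree_pderiv[of "geg d l"] Suc by simp
  qed simp
  ultimately show ?case
    by (auto intro!: degree_diff_le order_trans[OF degree_smult_le] simp del: mult_pCons_left)
qed simp

section \<open>Normalisation at 1 and identification with the Jacobi polynomials\<close>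

lemma poly_geg_1: "poly (geg d l) 1 = 1"
  by (induction l) (auto)

text \<open>In powers of \<open>t - 1\<close> the equation is a first order recursion for the coefficients.\<close>

lemma geg_op_eq_0:
  assumes d: "d > 0" and e: "geg_op d p = smult \<mu> p" and p1: "poly p 1 = 0"
  shows "p = 0"
proof -
  define q where "q = pcompose p [:1, 1:]"
  have p2: "pderiv (pderiv q) = pcompose (pderiv (pderiv p)) [:1, 1:]"
    "pderiv q = pcompose (pderiv p) [:1, 1:]"
    by (simp_all add: q_def pderiv_pcompose pderiv_pCons)
  have ode: "[:0, -2, -1:] * pderiv (pderiv q) - smult d ([:1, 1:] * pderiv q) = smult \<mu> q"
  proof (rule poly_ext)
    fix t
    show "poly ([:0, -2, -1:] * pderiv (pderiv q) - smult d ([:1, 1:] * pderiv q)) t = poly (smult \<mu> q) t"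
      using arg_cong[OF e, where f = "\<lambda>p. poly p (1 + t)"] unfolding p2(1) unfolding p2(2)
      by (simp add: q_def poly_geg_op poly_pcompose power2_eq_square algebra_simps)
  qed
  have "coeff q k = 0" for k
  proof (induction k)
    case 0
    have "poly q 0 = 0"
      using p1 by (simp add: q_def poly_pcompose)
    then show ?case
      by (simp add: poly_0_coeff_0)
  next
    case (Suc k)
    \<comment> \<open>With \<open>coeff q k\<close> zero, only this term survives in the coefficient
      of t^k of the equation. Both factors in front are positive because
      \<open>d > 0\<close>.\<close>
    have "(real k + 1) * (2 * real k + d) * coeff q (Suc k) = 0"
      using arg_cong[OF ode, where f = "\<lambda>p. coeff p k"] Suc
      by (cases k; cases "k - 1") (simp_all add: coeff_pderiv coeff_pCons algebra_simps)
    then show ?case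
      using d by (auto simp: add_nonneg_eq_0_iff)
  qed
  then have "q = 0"
    by (simp add: poly_eq_iff)
  then show ?thesis
    by (simp add: q_def pcompose_eq_0_iff)
qed

text \<open>Represents \<open>jacobi_P\<close> with equal parameters as a polynomial object to which
  \<open>pderiv\<close> applies. The two linear factors are (t - 1)/2 and (t + 1)/2.\<close>

definition jac_poly :: "nat \<Rightarrow> real \<Rightarrow> real poly" where
  "jac_poly n \<alpha> = (\<Sum>s\<le>n. smult (((real n + \<alpha>) gchoose s) * ((real n + \<alpha>) gchoose (n - s)))
     ([:-1/2, 1/2:] ^ (n - s) * [:1/2, 1/2:] ^ s))"

lemma poly_jac_poly: "poly (jac_poly n \<alpha>) t = jacobi_P n \<alpha> \<alpha> t"
  by (simp add: jac_poly_def jacobi_P_def poly_sum mult.assoc)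
    (intro sum.cong refl, simp add: field_simps)

lemma poly_pderiv_half_power:
  "poly (pderiv ([:c/2, 1/2:] ^ n)) t = real n / 2 * ((t + c) / 2) ^ (n - 1)"
  by (simp add: pderiv_power pderiv_pCons add.commute add_divide_distrib) 

lemma poly_pderiv2_half_power:
  "poly (pderiv (pderiv ([:c/2, 1/2:] ^ n))) t = real n * (real n - 1) / 4 * ((t + c) / 2) ^ (n - 2)"
proof (cases n)
  case (Suc m)
  have "pderiv ([:c/2, 1/2:] ^ n) = smult (real n / 2) ([:c/2, 1/2:] ^ m)"
    by (rule poly_ext) (simp add: poly_pderiv_half_power Suc add.commute add_divide_distrib del: power_Suc)
  then show ?thesis
    using poly_pderiv_half_power[of c m t] by (simp add: pderiv_smult Suc numeral_2_eq_2)
qed simp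

text \<open>In u = (t - 1)/2 and v = (t + 1)/2 one has t = u + v and 1 - t^2 = -4uv, so the operator
  maps u^a v^b to monomials of the same total degree. Where \<open>a - 1\<close> or
  \<open>b - 1\<close> underflows, its coefficient is 0.\<close>

lemma geg_op_half_powers:
  fixes \<alpha> :: real
  defines "M \<equiv> \<lambda>a b. [:-1/2, 1/2:] ^ a * [:1/2, 1/2:] ^ b"
  shows "geg_op (2 * \<alpha> + 2) (M a b) = - (smult (real a * (real a + \<alpha>)) (M (a - 1) (b + 1))
    + smult (real b * (real b + \<alpha>)) (M (a + 1) (b - 1))
    + smult (2 * real a * real b + (\<alpha> + 1) * (real a + real b)) (M a b))"
proof (rule poly_ext)
  fix t :: real
  define u v where "u = (t - 1) / 2" and "v = (t + 1) / 2"
  have t: "t = u + v" and t2: "1 - t\<^sup>2 = - 4 * u * v"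
    by (simp_all add: u_def v_def power2_eq_square field_simps)
  let ?u = "[:-1/2, 1/2:] :: real poly" and ?v = "[:1/2, 1/2:] :: real poly"
  have uv: "poly ?u t = u" "poly ?v t = v"
    "poly (pderiv (?u ^ n)) t = real n / 2 * u ^ (n - 1)"
    "poly (pderiv (?v ^ n)) t = real n / 2 * v ^ (n - 1)"
    "poly (pderiv (pderiv (?u ^ n))) t = real n * (real n - 1) / 4 * u ^ (n - 2)"
    "poly (pderiv (pderiv (?v ^ n))) t = real n * (real n - 1) / 4 * v ^ (n - 2)" for n
    using poly_pderiv_half_power[of "-1" n t] poly_pderiv_half_power[of 1 n t]
      poly_pderiv2_half_power[of "-1" n t] poly_pderiv2_half_power[of 1 n t]
    by (simp_all add: u_def v_def field_simps)
  have M: "poly (M a b) t = u ^ a * v ^ b" for a b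
    unfolding M_def poly_mult poly_power uv ..
  have M1: "poly (pderiv (M a b)) t = real a / 2 * u ^ (a - 1) * v ^ b + u ^ a * (real b / 2 * v ^ (b - 1))"
    unfolding M_def pderiv_mult poly_add poly_mult uv poly_power by simp
  have M2: "poly (pderiv (pderiv (M a b))) t = real a * (real a - 1) / 4 * u ^ (a - 2) * v ^ b
      + 2 * (real a / 2 * u ^ (a - 1) * (real b / 2 * v ^ (b - 1)))
      + u ^ a * (real b * (real b - 1) / 4 * v ^ (b - 2))"
    unfolding M_def pderiv_mult pderiv_add poly_add poly_mult uv poly_power by simp
  \<comment> \<open>Absorbs a factor into a truncated exponent; whenever the exponent underflows,
    the numerical factor is 0.\<close>
  have shift: "real a * (w ^ (a - 1) * w) = real a * w ^ a"
    "real a * (real a - 1) * (w ^ (a - 2) * w) = real a * (real a - 1) * w ^ (a - 1)" for a and w :: real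
  proof -
    show "real a * (w ^ (a - 1) * w) = real a * w ^ a"
      by (cases a) simp_all
    show "real a * (real a - 1) * (w ^ (a - 2) * w) = real a * (real a - 1) * w ^ (a - 1)"
      by (cases a; cases "a - 1") (simp_all add: numeral_2_eq_2)
  qed
  have "poly (geg_op (2 * \<alpha> + 2) (M a b)) t
      = - ((real a * (real a - 1) * (u ^ (a - 2) * u)) * (v ^ b * v)
        + 2 * (real a * (u ^ (a - 1) * u)) * (real b * (v ^ (b - 1) * v))
        + (u ^ a * u) * (real b * (real b - 1) * (v ^ (b - 2) * v)))
        - (\<alpha> + 1) * (real a * (u ^ (a - 1) * u) * v ^ b + real a * u ^ (a - 1) * (v ^ b * v)
        + real b * v ^ (b - 1) * (u ^ a * u) + u ^ a * (real b * (v ^ (b - 1) * v)))"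
    unfolding poly_geg_op t2 M1 M2 unfolding t by (simp add: field_simps)
  also have "\<dots> = poly (- (smult (real a * (real a + \<alpha>)) (M (a - 1) (b + 1))
    + smult (real b * (real b + \<alpha>)) (M (a + 1) (b - 1))
    + smult (2 * real a * real b + (\<alpha> + 1) * (real a + real b)) (M a b))) t"
    unfolding shift by (simp add: M algebra_simps)
  finally show "poly (geg_op (2 * \<alpha> + 2) (M a b)) t = \<dots>" .
qed

lemma geg_op_jac_poly:
  "geg_op (2 * \<alpha> + 2) (jac_poly n \<alpha>) = smult (- (real n * (real n + 2 * \<alpha> + 1))) (jac_poly n \<alpha>)"
proof -
  define A where "A s = ((real n + \<alpha>) gchoose s) * ((real n + \<alpha>) gchoose (n - s))" for s
  define M where "M s = [:-1/2, 1/2:] ^ (n - s) * [:1/2, 1/2 :: real:] ^ s" for s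
  \<comment> \<open>Passing from s to s + 1 changes each of the two binomial coefficients by one
    quotient; the denominators are cleared here.\<close>
  have A_Suc: "A (Suc s) * ((real s + 1) * (real s + 1 + \<alpha>)) = A s * ((real n + \<alpha> - real s) * (real n - real s))"
    if "s < n" for s
  proof -
    have ns: "n - s = Suc (n - Suc s)"
      using that by simp
    have g: "(x gchoose Suc k) * (real k + 1) = (x gchoose k) * (x - real k)" for x :: real and k
      using gbinomial_absorb_comp[of x k] gbinomial_absorption[of k x] by (simp add: algebra_simps)
    have 1: "((real n + \<alpha>) gchoose Suc s) * (real s + 1) = ((real n + \<alpha>) gchoose s) * (real n + \<alpha> - real s)"
      by (rule g)
    have 2: "((real n + \<alpha>) gchoose (n - s)) * (real n - real s)
        = ((real n + \<alpha>) gchoose (n - Suc s)) * (real s + 1 + \<alpha>)"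
      using g[of "real n + \<alpha>" "n - Suc s"] that unfolding ns by (simp add: of_nat_diff algebra_simps)
    have "A (Suc s) * ((real s + 1) * (real s + 1 + \<alpha>))
        = (((real n + \<alpha>) gchoose Suc s) * (real s + 1)) * (((real n + \<alpha>) gchoose (n - Suc s)) * (real s + 1 + \<alpha>))"
      by (simp add: A_def)
    also have "\<dots> = A s * ((real n + \<alpha> - real s) * (real n - real s))"
      unfolding 1 2[symmetric] by (simp add: A_def)
    finally show ?thesis .
  qed
  have L: "geg_op (2 * \<alpha> + 2) (M s) = - (smult ((real n - real s) * (real n - real s + \<alpha>)) (M (s + 1))
      + smult (real s * (real s + \<alpha>)) (M (s - 1))
      + smult (2 * (real n - real s) * real s + (\<alpha> + 1) * real n) (M s))" if "s \<le> n" for s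
    using geg_op_half_powers[of \<alpha> "n - s" s] that
    by (cases "s = 0") (simp_all add: M_def of_nat_diff Suc_diff_le)
  have "geg_op (2 * \<alpha> + 2) (jac_poly n \<alpha>) = (\<Sum>s\<le>n. smult (A s) (geg_op (2 * \<alpha> + 2) (M s)))"
  proof -
    have "geg_op c (\<Sum>s\<in>S. smult (A s) (M s)) = (\<Sum>s\<in>S. smult (A s) (geg_op c (M s)))" if "finite S" for S c
      using that by (induction S) (simp_all add: geg_op_add geg_op_smult, simp add: geg_op_def)
    then show ?thesis
      by (simp add: jac_poly_def A_def M_def)
  qed
  also have "\<dots> = - ((\<Sum>s\<le>n. smult (A s * ((real n - real s) * (real n - real s + \<alpha>))) (M (s + 1)))
      + (\<Sum>s\<le>n. smult (A s * (real s * (real s + \<alpha>))) (M (s - 1)))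
      + (\<Sum>s\<le>n. smult (A s * (2 * (real n - real s) * real s + (\<alpha> + 1) * real n)) (M s)))"
    unfolding sum.distrib[symmetric] sum_negf[symmetric]
    by (intro sum.cong refl) (simp add: L smult_add_right smult_diff_right)
  \<comment> \<open>The term s = n drops because of the factor n - s. Then \<open>A_Suc\<close>
    passes to the index s + 1, and reindexing returns to \<open>M s\<close>, the added term s = 0
    being zero. The sum with \<open>M (s - 1)\<close> is treated in the opposite direction.\<close>
  also have "(\<Sum>s\<le>n. smult (A s * ((real n - real s) * (real n - real s + \<alpha>))) (M (s + 1)))
      = (\<Sum>s<n. smult (A s * ((real n + \<alpha> - real s) * (real n - real s))) (M (Suc s)))"
    by (subst lessThan_Suc_atMost[symmetric]) (simp add: algebra_simps)
  also have "\<dots> = (\<Sum>s<n. smult (A (Suc s) * ((real s + 1) * (real s + 1 + \<alpha>))) (M (Suc s)))"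
    by (intro sum.cong refl) (simp add: A_Suc)
  also have "\<dots> = (\<Sum>s\<le>n. smult (A s * (real s * (real s + \<alpha>))) (M s))"
    by (subst sum.atMost_shift) (simp add: add.commute)
  also have "(\<Sum>s\<le>n. smult (A s * (real s * (real s + \<alpha>))) (M (s - 1)))
      = (\<Sum>s<n. smult (A (Suc s) * ((real s + 1) * (real s + 1 + \<alpha>))) (M s))"
    by (subst sum.atMost_shift) (simp add: add.commute)
  also have "\<dots> = (\<Sum>s<n. smult (A s * ((real n + \<alpha> - real s) * (real n - real s))) (M s))"
    by (intro sum.cong refl) (simp add: A_Suc)
  also have "\<dots> = (\<Sum>s\<le>n. smult (A s * ((real n + \<alpha> - real s) * (real n - real s))) (M s))"
    by (subst lessThan_Suc_atMost[symmetric]) simp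
  \<comment> \<open>The coefficients add up independently of s: s^2 + (n - s)^2 + 2 s (n - s) = n^2,
    and the terms in \<alpha> give 2 \<alpha> n.\<close>
  also have "- ((\<Sum>s\<le>n. smult (A s * (real s * (real s + \<alpha>))) (M s))
      + (\<Sum>s\<le>n. smult (A s * ((real n + \<alpha> - real s) * (real n - real s))) (M s))
      + (\<Sum>s\<le>n. smult (A s * (2 * (real n - real s) * real s + (\<alpha> + 1) * real n)) (M s)))
      = (\<Sum>s\<le>n. smult (A s * (- (real n * (real n + 2 * \<alpha> + 1)))) (M s))"
    by (simp add: smult_add_left[symmetric] sum.distrib[symmetric] sum_negf[symmetric] smult_minus_left[symmetric]
        del: smult_minus_left) (intro sum.cong refl arg_cong2[where f = smult], auto simp: algebra_simps)
  also have "\<dots> = smult (- (real n * (real n + 2 * \<alpha> + 1))) (jac_poly n \<alpha>)"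
    unfolding jac_poly_def A_def M_def
    by (rule poly_ext) (simp add: poly_sum sum_distrib_left sum_negf mult_ac)
  finally show ?thesis .
qed

text \<open>At 1 every term but \<open>s = n\<close> contains a factor 0, and the remaining binomial
  coefficient is a product of positive factors.\<close>

lemma jacobi_P_1_pos:
  assumes "\<alpha> \<ge> 0"
  shows "jacobi_P n \<alpha> \<beta> 1 > 0"
proof -
  have "jacobi_P n \<alpha> \<beta> 1 = (\<Sum>s\<le>n. if s = n then (real n + \<alpha>) gchoose n else 0)"
    unfolding jacobi_P_def by (intro sum.cong) auto
  also have "\<dots> = (real n + \<alpha>) gchoose n"
    by simp
  also have "\<dots> > 0"
    using assms by (auto simp: gbinomial_prod_rev intro!: prod_pos divide_pos_pos)
  finally show ?thesis .
qed

text \<open>Both polynomials solve the Gegenbauer equation with the same eigenvalue. After scaling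
  they agree at 1, so their difference vanishes by \<open>geg_op_eq_0\<close>.\<close>

lemma gegenbauer_P_eq_geg:
  assumes d: "d \<ge> 2"
  shows "gegenbauer_P d l t = poly (geg d l) t"
proof -
  define \<alpha> where "\<alpha> = (real d - 2) / 2"
  have \<alpha>: "\<alpha> \<ge> 0" "2 * \<alpha> + 2 = real d"
    using d by (simp_all add: \<alpha>_def field_simps)
  define c where "c = jacobi_P l \<alpha> \<alpha> 1"
  have c: "c > 0"
    using jacobi_P_1_pos \<alpha>(1) by (simp add: c_def)
  define p where "p = jac_poly l \<alpha> + smult (- c) (geg d l)"
  define \<mu> where "\<mu> = - (real l * (real l + real d - 1))"
  have "geg_op (real d) (jac_poly l \<alpha>) = smult \<mu> (jac_poly l \<alpha>)"
    using geg_op_jac_poly[of \<alpha> l] unfolding \<mu>_def \<alpha>(2)[symmetric] by (simp add: algebra_simps)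
  then have "geg_op (real d) p = smult \<mu> p"
    unfolding p_def geg_op_add geg_op_smult geg_op_geg[OF d] \<mu>_def[symmetric]
    by (simp add: smult_diff_right mult.commute)
  moreover have "poly p 1 = 0"
    by (simp add: p_def poly_jac_poly poly_geg_1 c_def)
  ultimately have "p = 0"
    using geg_op_eq_0[of "real d" p] d by simp
  then have "jacobi_P l \<alpha> \<alpha> t = c * poly (geg d l) t"
    by (simp add: p_def poly_jac_poly[symmetric])
  then show ?thesis
    using c by (simp add: gegenbauer_P_def \<alpha>_def[symmetric] c_def[symmetric])
qed

section \<open>Integration by parts on the sphere\<close>

text \<open>For \<open>i \<noteq> j\<close> this turns the axis \<open>i\<close> towards the axis
  \<open>j\<close> and fixes the orthogonal complement; for \<open>i = j\<close> it is not
  orthogonal in general.\<close>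

definition plane_rotation :: "'n \<Rightarrow> 'n \<Rightarrow> real \<Rightarrow> real ^ 'n \<Rightarrow> real ^ 'n" where
  "plane_rotation i j \<theta> z = z + (cos \<theta> - 1) *\<^sub>R ((z $ i) *\<^sub>R axis i 1 + (z $ j) *\<^sub>R axis j 1)
     + sin \<theta> *\<^sub>R ((z $ i) *\<^sub>R axis j 1 - (z $ j) *\<^sub>R axis i 1)"

lemma plane_rotation_0 [simp]: "plane_rotation i j 0 z = z"
  by (simp add: plane_rotation_def)

lemma orthogonal_transformation_plane_rotation:
  fixes i j :: "'n::finite"
  assumes "i \<noteq> j"
  shows "orthogonal_transformation (plane_rotation i j \<theta>)"
  unfolding orthogonal_transformation_def
proof (intro conjI allI)
  show "linear (plane_rotation i j \<theta>)"
    by (rule linearI) (simp_all add: plane_rotation_def algebra_simps)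
  fix v w :: "real ^ 'n"
  have 1: "axis i 1 \<bullet> axis i (1::real) = 1" "axis j 1 \<bullet> axis j (1::real) = 1"
    "axis i 1 \<bullet> axis j (1::real) = 0" "axis j 1 \<bullet> axis i (1::real) = 0"
    using assms by (auto simp: inner_axis_axis)
  have 2: "axis i (1::real) $ j = 0" "axis j (1::real) $ i = 0"
    using assms by (auto simp: axis_def)
  define c s where "c = cos \<theta>" and "s = sin \<theta>"
  have cs: "s * s = 1 - c * c"
    using sin_cos_squared_add[of \<theta>] by (simp add: c_def s_def power2_eq_square)
  have "plane_rotation i j \<theta> v \<bullet> plane_rotation i j \<theta> w
      = v \<bullet> w + (s * s + c * c - 1) * (v $ i * w $ i + v $ j * w $ j)"
    unfolding plane_rotation_def c_def[symmetric] s_def[symmetric]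
    by (simp add: inner_add_left inner_add_right inner_diff_left inner_diff_right 1 2 inner_axis inner_axis')
      (simp add: algebra_simps)
  then show "plane_rotation i j \<theta> v \<bullet> plane_rotation i j \<theta> w = v \<bullet> w"
    by (simp add: cs)
qed

definition rotation_field :: "'n \<Rightarrow> 'n \<Rightarrow> real ^ 'n \<Rightarrow> real ^ 'n" where
  "rotation_field i j z = (z $ i) *\<^sub>R axis j 1 - (z $ j) *\<^sub>R axis i 1"

text \<open>The velocity is expressed at the rotated point, so that a single function on space gives
  the derivative at every angle.\<close>

lemma plane_rotation_has_vector_derivative:
  assumes "i \<noteq> j"
  shows "((\<lambda>\<theta>. plane_rotation i j \<theta> z) has_vector_derivative
    rotation_field i j (plane_rotation i j \<theta> z)) (at \<theta>)"
proof -
  have "((\<lambda>\<theta>. plane_rotation i j \<theta> z) has_vector_derivative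
    (- sin \<theta>) *\<^sub>R ((z $ i) *\<^sub>R axis i 1 + (z $ j) *\<^sub>R axis j 1)
     + cos \<theta> *\<^sub>R ((z $ i) *\<^sub>R axis j 1 - (z $ j) *\<^sub>R axis i 1)) (at \<theta>)"
    unfolding plane_rotation_def by (auto intro!: derivative_eq_intros)
  also have "(- sin \<theta>) *\<^sub>R ((z $ i) *\<^sub>R axis i 1 + (z $ j) *\<^sub>R axis j 1)
     + cos \<theta> *\<^sub>R ((z $ i) *\<^sub>R axis j 1 - (z $ j) *\<^sub>R axis i 1)
     = rotation_field i j (plane_rotation i j \<theta> z)"
    using assms by (simp add: plane_rotation_def rotation_field_def axis_def vec_eq_iff algebra_simps)
  finally show ?thesis .
qed

section \<open>Derivatives along rotations integrate to zero\<close>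

lemma integrable_sphere_measure:
  fixes F :: "real ^ 'n \<Rightarrow> real"
  assumes "continuous_on UNIV F"
  shows "integrable \<sigma>\<^sub>S F"
proof -
  have "compact (F ` sphere 0 1)"
    by (intro compact_continuous_image continuous_on_subset[OF assms]) auto
  then obtain B where "\<forall>z\<in>sphere 0 1. norm (F z) \<le> B"
    using compact_imp_bounded bounded_iff by (metis imageI)
  then show ?thesis
    using assms
    by (intro finite_measure.integrable_const_bound[OF finite_measure_sphere_measure, of _ B])
      (auto intro!: borel_measurable_sphere_measure borel_measurable_continuous_onI)
qed

text \<open>By rotation invariance the integral of \<open>g\<close> composed with a rotation does
  not depend on the angle. Its derivative at angle 0, taken under the integral, is the integral in
  question.\<close>

lemma integral_rotation_field:
  fixes g :: "real ^ 'n \<Rightarrow> real"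
  assumes g: "\<And>z. (g has_derivative g' z) (at z)"
    and cont: "continuous_on UNIV (\<lambda>z. g' z (rotation_field i j z))"
  shows "(\<integral>z. g' z (rotation_field i j z) \<partial>\<sigma>\<^sub>S) = 0"
proof (cases "i = j")
  case True
  have "g' z 0 = 0" for z
    using g[of z] by (simp add: has_derivative_bounded_linear linear_simps)
  then show ?thesis
    by (simp add: rotation_field_def True)
next
  case False
  define D where "D z = g' z (rotation_field i j z)" for z
  let ?R = "plane_rotation i j"
  have deriv: "((\<lambda>\<theta>. g (?R \<theta> z)) has_real_derivative D (?R \<theta> z)) (at \<theta>)" for \<theta> z
    using vector_derivative_diff_chain_within[OF plane_rotation_has_vector_derivative[OF False], of g "g' (?R \<theta> z)" \<theta> z]
      has_derivative_at_withinI[OF g]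
    by (simp add: D_def has_real_derivative_iff_has_vector_derivative o_def)
  have cD: "continuous_on UNIV D"
    unfolding D_def by (rule cont)
  have "compact (D ` sphere 0 1)"
    by (intro compact_continuous_image continuous_on_subset[OF cD]) auto
  then obtain B where "\<forall>z\<in>sphere 0 1. \<bar>D z\<bar> \<le> B"
    by (auto simp: bounded_iff dest!: compact_imp_bounded)
  then have B: "\<bar>D z\<bar> \<le> B" if "norm z = 1" for z
    using that by simp
  have nrm: "norm (?R \<theta> z) = norm z" for \<theta> z
    using orthogonal_transformation_plane_rotation[OF False] by (simp add: orthogonal_transformation)
  have cg: "continuous_on UNIV g"
    using g by (intro has_derivative_continuous_on[where f' = g']) (simp add: has_derivative_at_withinI)
  have cR: "continuous_on UNIV (?R \<theta>)" for \<theta>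
    by (intro linear_continuous_on linear_conv_bounded_linear[THEN iffD1])
      (use orthogonal_transformation_plane_rotation[OF False] in \<open>simp add: orthogonal_transformation_def\<close>)
  have cgR: "continuous_on UNIV (\<lambda>z. g (?R \<theta> z))" for \<theta>
    using continuous_on_compose2[OF cg cR] by simp
  \<comment> \<open>Difference quotients at the angles 1 / (n + 1): a sequence, as dominated
    convergence requires.\<close>
  define s where "s n z = (g (?R (1 / (real n + 1)) z) - g z) * (real n + 1)" for n z
  have lim: "(\<lambda>n. integral\<^sup>L \<sigma>\<^sub>S (s n)) \<longlonglongrightarrow> integral\<^sup>L \<sigma>\<^sub>S D"
  proof (rule integral_dominated_convergence[where w = "\<lambda>_. B"])
    show "integrable \<sigma>\<^sub>S (\<lambda>_ :: real ^ 'n. B)"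
      by (intro integrable_sphere_measure) auto
    show "D \<in> borel_measurable \<sigma>\<^sub>S"
      by (intro borel_measurable_sphere_measure borel_measurable_continuous_onI cD)
    show "s n \<in> borel_measurable \<sigma>\<^sub>S" for n
      unfolding s_def by (intro borel_measurable_sphere_measure borel_measurable_continuous_onI
          continuous_intros cg cgR)
    show "AE z in \<sigma>\<^sub>S. (\<lambda>n. s n z) \<longlonglongrightarrow> D z"
    proof (rule AE_I2)
      fix z :: "real ^ 'n"
      have "((\<lambda>\<theta>. (g (?R \<theta> z) - g z) / \<theta>) \<longlongrightarrow> D z) (at 0)"
        using deriv[of z 0] by (simp add: DERIV_def)
      moreover have "filterlim (\<lambda>n. 1 / (real n + 1)) (at 0) sequentially"
        by (rule filterlim_atI[OF _ eventuallyI]) (use LIMSEQ_inverse_real_of_nat in \<open>simp_all add: inverse_eq_divide add.commute\<close>)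
      ultimately show "(\<lambda>n. s n z) \<longlonglongrightarrow> D z"
        by (drule_tac filterlim_compose) (auto simp: s_def field_simps)
    qed
    show "AE z in \<sigma>\<^sub>S. norm (s n z) \<le> B" for n
    proof (rule AE_I2)
      fix z :: "real ^ 'n"
      assume z: "z \<in> space \<sigma>\<^sub>S"
      define \<epsilon> where "\<epsilon> = 1 / (real n + 1)"
      have \<epsilon>: "\<epsilon> > 0"
        by (simp add: \<epsilon>_def)
      \<comment> \<open>By the mean value theorem each quotient is a value of \<open>D\<close> at a
        rotated point, which still lies on the sphere, so \<open>B\<close> bounds it uniformly in
        \<open>n\<close>.\<close>
      obtain \<xi> where "g (?R \<epsilon> z) - g (?R 0 z) = (\<epsilon> - 0) * D (?R \<xi> z)"
        using MVT2[of 0 \<epsilon> "\<lambda>\<theta>. g (?R \<theta> z)" "\<lambda>\<theta>. D (?R \<theta> z)"] deriv \<epsilon> by blast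
      then have "s n z = D (?R \<xi> z)"
        by (simp add: s_def \<epsilon>_def)
      then show "norm (s n z) \<le> B"
        using B[of "?R \<xi> z"] z nrm by simp
    qed
  qed
  have "integral\<^sup>L \<sigma>\<^sub>S (s n) = 0" for n
  proof -
    have "(\<integral>z. g (?R (1 / (real n + 1)) z) - g z \<partial>\<sigma>\<^sub>S) = 0"
      using integral_sphere_measure_orthogonal[OF orthogonal_transformation_plane_rotation[OF False]
          borel_measurable_continuous_onI[OF cg]]
      by (subst Bochner_Integration.integral_diff) (auto intro!: integrable_sphere_measure cg cgR)
    then show ?thesis
      by (simp add: s_def[abs_def])
  qed
  with lim show ?thesis
    by (simp add: D_def[abs_def] LIMSEQ_const_iff)
qed

section \<open>Integrals of products of two zonal polynomials\<close>

definition zonal_inner :: "real ^ 'n \<Rightarrow> real ^ 'n \<Rightarrow> real poly \<Rightarrow> real poly \<Rightarrow> real" where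
  "zonal_inner x y p q = (\<integral>z. poly p (x \<bullet> z) * poly q (y \<bullet> z) \<partial>\<sigma>\<^sub>S)"

lemma integrable_zonal: "integrable \<sigma>\<^sub>S (\<lambda>z. poly p (x \<bullet> z) * poly q (y \<bullet> z))"
  by (intro integrable_sphere_measure continuous_intros)

lemma zonal_inner_add: "zonal_inner x y (p + p') q = zonal_inner x y p q + zonal_inner x y p' q"
  using integrable_zonal[of p x q y] integrable_zonal[of p' x q y]
  by (simp add: zonal_inner_def distrib_right)

lemma zonal_inner_smult: "zonal_inner x y (smult c p) q = c * zonal_inner x y p q"
  by (simp add: zonal_inner_def mult.assoc)

lemma zonal_inner_commute: "zonal_inner x y p q = zonal_inner y x q p"
  by (simp add: zonal_inner_def mult.commute)

text \<open>
  The fields \<open>G\<^sub>i(z) = z\<^sub>i p'(x \<bullet> z) q(y \<bullet> z)\<close>, differentiated along the rotation from \<open>e\<^sub>i\<close> to \<open>x\<close> and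
  summed over \<open>i\<close>, give the divergence of \<open>q(y \<bullet> z)\<close> times the spherical gradient of \<open>p(x \<bullet> z)\<close>.
\<close>

lemma zonal_inner_geg_op:
  fixes x y :: "real ^ 'n"
  assumes x: "norm x = 1"
  shows "zonal_inner x y (geg_op (real CARD('n) - 1) p) q
    = zonal_inner x y ([:0, 1:] * pderiv p) ([:0, 1:] * pderiv q)
      - (x \<bullet> y) * zonal_inner x y (pderiv p) (pderiv q)"
proof -
  define P1 where "P1 z = poly (pderiv p) (x \<bullet> z)" for z
  define P2 where "P2 z = poly (pderiv (pderiv p)) (x \<bullet> z)" for z
  define Q where "Q z = poly q (y \<bullet> z)" for z
  define Q1 where "Q1 z = poly (pderiv q) (y \<bullet> z)" for z
  define G where "G i z = z $ i * (P1 z * Q z)" for i z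
  define G' where "G' i z v = v $ i * (P1 z * Q z)
    + z $ i * ((x \<bullet> v) * P2 z * Q z + P1 z * ((y \<bullet> v) * Q1 z))" for i z v
  note defs = P1_def P2_def Q_def Q1_def
  have pd: "((\<lambda>z. poly r (a \<bullet> z)) has_derivative (\<lambda>v. (a \<bullet> v) * poly (pderiv r) (a \<bullet> z))) (at z)"
    for r and a z :: "real ^ 'n"
  proof (rule has_derivative_compose[of "\<lambda>z. a \<bullet> z" "\<lambda>v. a \<bullet> v"])
    show "((\<lambda>z. a \<bullet> z) has_derivative (\<lambda>v. a \<bullet> v)) (at z)"
      by (rule has_derivative_inner_right[OF has_derivative_ident])
    show "(poly r has_derivative (\<lambda>v. v * poly (pderiv r) (a \<bullet> z))) (at (a \<bullet> z))"
      using poly_DERIV[of r "a \<bullet> z"] unfolding has_field_derivative_def mult_commute_abs .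
  qed
  have GD: "(G i has_derivative G' i z) (at z)" for i z
    unfolding G_def G'_def defs
    by (rule derivative_eq_intros pd bounded_linear_imp_has_derivative bounded_linear_vec_nth refl | simp add: algebra_simps)+
  have cont: "continuous_on UNIV (\<lambda>z. G' i z (rotation_field i j z))" for i j
    unfolding G'_def defs rotation_field_def by (intro continuous_intros)
  have "(\<integral>z. (\<Sum>i\<in>UNIV. \<Sum>j\<in>UNIV. x $ j * G' i z (rotation_field i j z)) \<partial>\<sigma>\<^sub>S)
      = (\<Sum>i\<in>UNIV. \<Sum>j\<in>UNIV. x $ j * (\<integral>z. G' i z (rotation_field i j z) \<partial>\<sigma>\<^sub>S))"
    using integrable_sphere_measure[OF cont] by (simp add: integrable_sum integrable_mult_right)
  also have "\<dots> = 0"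
    by (simp add: integral_rotation_field[OF GD cont])
  finally have zero: "(\<integral>z. (\<Sum>i\<in>UNIV. \<Sum>j\<in>UNIV. x $ j * G' i z (rotation_field i j z)) \<partial>\<sigma>\<^sub>S) = 0" .
  have pt: "(\<Sum>i\<in>UNIV. \<Sum>j\<in>UNIV. x $ j * G' i z (rotation_field i j z))
      = poly (geg_op (real CARD('n) - 1) p) (x \<bullet> z) * Q z
        + (x \<bullet> y) * (P1 z * Q1 z) - ((x \<bullet> z) * P1 z) * ((y \<bullet> z) * Q1 z)"
    if z: "norm z = 1" for z
  proof -
    have V: "a \<bullet> rotation_field i j z = z $ i * a $ j - z $ j * a $ i" for a i j
      by (simp add: rotation_field_def inner_diff_right inner_axis)
    have in1: "(\<Sum>j\<in>UNIV. a $ j * b $ j) = a \<bullet> b" for a b :: "real ^ 'n"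
      by (simp add: inner_vec_def)
    have xx: "x \<bullet> x = 1" "z \<bullet> z = 1"
      using x z by (simp_all add: norm_eq_1)
    \<comment> \<open>Comes from differentiating the factor \<open>z $ i\<close> and yields the
      first order term of \<open>geg_op\<close>.\<close>
    have S1: "(\<Sum>i\<in>UNIV. \<Sum>j\<in>UNIV. x $ j * (rotation_field i j z $ i)) = (1 - real CARD('n)) * (x \<bullet> z)"
    proof -
      have "(\<Sum>j\<in>UNIV. x $ j * (rotation_field i j z $ i)) = x $ i * z $ i - x \<bullet> z" for i
        by (simp add: rotation_field_def axis_def right_diff_distrib sum_subtractf in1[symmetric]
            if_distrib[of "\<lambda>u. _ * u"] cong: if_cong)
      then have "(\<Sum>i\<in>UNIV. \<Sum>j\<in>UNIV. x $ j * (rotation_field i j z $ i))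
          = (\<Sum>i\<in>UNIV. x $ i * z $ i - x \<bullet> z)"
        by (simp only:)
      then show ?thesis
        by (simp add: sum_subtractf in1 left_diff_distrib)
    qed
    \<comment> \<open>For \<open>a = x\<close> this is 1 - (x . z)^2, the weight of the second
      derivative of \<open>p\<close>. For \<open>a = y\<close> it is the inner product of the
      tangential parts of \<open>x\<close> and \<open>y\<close>, the weight of the product of first
      derivatives.\<close>
    have S2: "(\<Sum>i\<in>UNIV. \<Sum>j\<in>UNIV. x $ j * (z $ i * (a \<bullet> rotation_field i j z))) = x \<bullet> a - (x \<bullet> z) * (a \<bullet> z)" for a
    proof -
      have "(\<Sum>j\<in>UNIV. x $ j * (z $ i * (a \<bullet> rotation_field i j z)))
          = z $ i * z $ i * (x \<bullet> a) - a $ i * z $ i * (x \<bullet> z)" for i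
      proof -
        have "(\<Sum>j\<in>UNIV. x $ j * (z $ i * (a \<bullet> rotation_field i j z)))
            = (\<Sum>j\<in>UNIV. z $ i * z $ i * (x $ j * a $ j) - a $ i * z $ i * (x $ j * z $ j))"
          unfolding V by (intro sum.cong refl) (simp add: algebra_simps)
        then show ?thesis
          by (simp only: sum_subtractf sum_distrib_left[symmetric] in1)
      qed
      then have "(\<Sum>i\<in>UNIV. \<Sum>j\<in>UNIV. x $ j * (z $ i * (a \<bullet> rotation_field i j z)))
          = (\<Sum>i\<in>UNIV. z $ i * z $ i * (x \<bullet> a) - a $ i * z $ i * (x \<bullet> z))"
        by (simp only:)
      then show ?thesis
        by (simp only: sum_subtractf sum_distrib_right[symmetric] in1 xx) simp
    qed
    have "(\<Sum>i\<in>UNIV. \<Sum>j\<in>UNIV. x $ j * G' i z (rotation_field i j z))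
        = (\<Sum>i\<in>UNIV. \<Sum>j\<in>UNIV. x $ j * (rotation_field i j z $ i)) * (P1 z * Q z)
        + (\<Sum>i\<in>UNIV. \<Sum>j\<in>UNIV. x $ j * (z $ i * (x \<bullet> rotation_field i j z))) * (P2 z * Q z)
        + (\<Sum>i\<in>UNIV. \<Sum>j\<in>UNIV. x $ j * (z $ i * (y \<bullet> rotation_field i j z))) * (P1 z * Q1 z)"
      unfolding sum_distrib_right sum.distrib[symmetric]
      by (intro sum.cong refl) (simp add: G'_def algebra_simps)
    also have "\<dots> = poly (geg_op (real CARD('n) - 1) p) (x \<bullet> z) * Q z
        + (x \<bullet> y) * (P1 z * Q1 z) - ((x \<bullet> z) * P1 z) * ((y \<bullet> z) * Q1 z)"
      unfolding S1 S2 poly_geg_op xx P1_def P2_def by (simp add: algebra_simps power2_eq_square)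
    finally show ?thesis .
  qed
  have "0 = (\<integral>z. poly (geg_op (real CARD('n) - 1) p) (x \<bullet> z) * Q z
        + (x \<bullet> y) * (P1 z * Q1 z) - ((x \<bullet> z) * P1 z) * ((y \<bullet> z) * Q1 z) \<partial>\<sigma>\<^sub>S)"
    unfolding zero[symmetric] by (intro Bochner_Integration.integral_cong) (auto simp: pt)
  also have "\<dots> = (\<integral>z. poly (geg_op (real CARD('n) - 1) p) (x \<bullet> z) * Q z \<partial>\<sigma>\<^sub>S)
      + (x \<bullet> y) * (\<integral>z. P1 z * Q1 z \<partial>\<sigma>\<^sub>S) - (\<integral>z. ((x \<bullet> z) * P1 z) * ((y \<bullet> z) * Q1 z) \<partial>\<sigma>\<^sub>S)"
    using integrable_zonal[of "geg_op (real CARD('n) - 1) p" x q y] integrable_zonal[of "pderiv p" x "pderiv q" y]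
      integrable_zonal[of "[:0, 1:] * pderiv p" x "[:0, 1:] * pderiv q" y]
    by (simp add: defs)
  finally show ?thesis
    by (simp add: zonal_inner_def defs)
qed

section \<open>The reproducing property\<close>

text \<open>The right-hand side of \<open>zonal_inner_geg_op\<close> is symmetric under exchanging
  \<open>(x, p)\<close> with \<open>(y, q)\<close>. Hence the eigenvalues of degrees
  \<open>l\<close> and \<open>m\<close> multiply the integral to the same number, and they are
  distinct.\<close>

lemma zonal_inner_geg_orthogonal:
  fixes x y :: "real ^ 'n"
  assumes d: "d \<ge> 2" "CARD('n) = d + 1" and x: "norm x = 1" and y: "norm y = 1" and "l \<noteq> m"
  shows "zonal_inner x y (geg d l) (geg d m) = 0"
proof -
  define \<mu> where "\<mu> l = - (real l * (real l + real d - 1))" for l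
  have op: "geg_op (real CARD('n) - 1) (geg d l) = smult (\<mu> l) (geg d l)" for l
    using geg_op_geg[OF d(1), of l] d(2) by (simp add: \<mu>_def)
  have "\<mu> l * zonal_inner x y (geg d l) (geg d m) = \<mu> m * zonal_inner y x (geg d m) (geg d l)"
    using zonal_inner_geg_op[OF x, of y "geg d l" "geg d m"] zonal_inner_geg_op[OF y, of x "geg d m" "geg d l"]
    unfolding op zonal_inner_smult
    by (simp add: inner_commute zonal_inner_commute[of y x] del: mult_pCons_left)
  then have "(\<mu> l - \<mu> m) * zonal_inner x y (geg d l) (geg d m) = 0"
    by (simp add: zonal_inner_commute[of y x] left_diff_distrib)
  moreover have "\<mu> l - \<mu> m = (real m - real l) * (real m + real l + real d - 1)"
    by (simp add: \<mu>_def algebra_simps)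
  ultimately show ?thesis
    using d(1) \<open>l \<noteq> m\<close> by auto
qed

lemma zonal_inner_geg_lincomb:
  fixes x y :: "real ^ 'n"
  assumes "d \<ge> 2" "CARD('n) = d + 1" "norm x = 1" "norm y = 1" "l \<noteq> m"
  shows "zonal_inner x y (smult a (geg d l) + smult b (geg d m)) (smult a' (geg d l) + smult b' (geg d m))
    = a * a' * zonal_inner x y (geg d l) (geg d l) + b * b' * zonal_inner x y (geg d m) (geg d m)"
proof -
  have "zonal_inner x y p (smult a' (geg d l) + smult b' (geg d m))
      = a' * zonal_inner x y p (geg d l) + b' * zonal_inner x y p (geg d m)" for p
    by (simp add: zonal_inner_commute[of x y] zonal_inner_add zonal_inner_smult)
  then show ?thesis
    using assms by (simp add: zonal_inner_add zonal_inner_smult zonal_inner_geg_orthogonal algebra_simps)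
qed

section \<open>Dimensions of the spaces of spherical harmonics\<close>

lemma Zdim_0: "d \<ge> 2 \<Longrightarrow> Zdim d 0 = 1"
proof -
  assume d: "d \<ge> 2"
  have eq: "Gamma (real d) = (real d - 1) * Gamma (real d - 1)"
  proof -
    have "real d - 1 \<notin> \<int>\<^sub>\<le>\<^sub>0"
      using d by (auto elim!: nonpos_Ints_cases)
    then show ?thesis
      using Gamma_plus1[of "real d - 1"] by simp
  qed
  have "Gamma (real d) > 0"
    using d by (intro Gamma_real_pos) auto
  then show ?thesis
    by (simp add: Zdim_def eq[symmetric])
qed

lemma Zdim_pos: "d \<ge> 2 \<Longrightarrow> Zdim d l > 0"
  by (auto simp: Zdim_def intro!: divide_pos_pos mult_pos_pos Gamma_real_pos)

text \<open>Each of the two Gamma factors that depend on \<open>l\<close> changes by one factor, by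
  \<open>Gamma_plus1\<close>; denominators are cleared for use in the recurrence.\<close>

lemma Zdim_Suc:
  assumes d: "d \<ge> 2"
  shows "Zdim d (Suc l) * ((2 * real l + real d - 1) * (real l + 1))
    = Zdim d l * ((2 * real l + real d + 1) * (real l + real d - 1))"
proof -
  define a where "a = real l + real d - 1"
  have a: "a > 0"
    using d by (simp add: a_def)
  have g1: "Gamma (a + 1) = a * Gamma a"
    using a by (intro Gamma_plus1) (auto elim!: nonpos_Ints_cases)
  have g2: "Gamma (real l + 1 + 1) = (real l + 1) * Gamma (real l + 1)"
    by (intro Gamma_plus1) (auto elim!: nonpos_Ints_cases)
  have "Gamma (real d) > 0" "Gamma (real l + 1) > 0"
    using d by (auto intro: Gamma_real_pos)
  moreover have "Zdim d (Suc l) = (2 * real l + real d + 1) * Gamma (a + 1) / (Gamma (real d) * Gamma (real l + 1 + 1))"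
    by (simp add: Zdim_def a_def algebra_simps)
  moreover have "Zdim d l = (2 * real l + real d - 1) * Gamma a / (Gamma (real d) * Gamma (real l + 1))"
    by (simp add: Zdim_def a_def)
  moreover have "k' * (a * G) / (D * (b * F)) * (k * b) = k * G / (D * F) * (k' * a)"
    if "D > 0" "F > 0" "b > 0" for k k' b G D F :: real
    using that by (simp add: field_simps)
  ultimately show ?thesis
    unfolding g1 g2 a_def[symmetric] by simp
qed

text \<open>Integration by parts with p = q = \<open>R\<close>: the operator applied to
  \<open>R\<close>, the product of t with its derivative, and \<open>R\<close> itself all lie in the
  span of degrees l and l + 2, where orthogonality leaves only diagonal integrals. The derivative of
  \<open>R\<close> is a multiple of degree l + 1.\<close>

lemma zonal_inner_geg_rec:
  fixes x y :: "real ^ 'n"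
  assumes d: "d \<ge> 2" "CARD('n) = d + 1" and x: "norm x = 1" and y: "norm y = 1"
  defines "E \<equiv> \<lambda>l. zonal_inner x y (geg d l) (geg d l)"
  shows "(x \<bullet> y) * (2 * real l + real d + 1)\<^sup>2 * E (Suc l)
    = (real l + real d)\<^sup>2 * (2 * real l + real d + 3) / (real l + 2) * E (Suc (Suc l))
      + (real l + 1)\<^sup>2 * (2 * real l + real d - 1) / (real l + real d - 1) * E l"
proof -
  define k where "k = 2 * real l + real d + 1"
  define \<alpha> \<beta> where "\<alpha> = (real l + real d) / (real l + 2)" and "\<beta> = - ((real l + 1) / (real l + real d - 1))"
  define \<mu> where "\<mu> l = - (real l * (real l + real d - 1))" for l
  define R where "R = smult \<alpha> (geg d (Suc (Suc l))) + smult \<beta> (geg d l)"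
  have R': "pderiv R = smult k (geg d (Suc l))"
    using geg_antiderivative[OF d(1), of l]
    by (simp add: R_def \<alpha>_def \<beta>_def k_def pderiv_diff pderiv_smult del: geg.simps(2))
  have XR': "[:0, 1:] * pderiv R = smult (real l + real d) (geg d (Suc (Suc l))) + smult (real l + 1) (geg d l)"
    using geg_three_term[OF d(1), of l] by (simp add: R' k_def del: geg.simps(2))
  have op: "geg_op (real CARD('n) - 1) (geg d l) = smult (\<mu> l) (geg d l)" for l
    using geg_op_geg[OF d(1), of l] d(2) by (simp add: \<mu>_def)
  have DR: "geg_op (real CARD('n) - 1) R = smult (\<alpha> * \<mu> (l + 2)) (geg d (Suc (Suc l))) + smult (\<beta> * \<mu> l) (geg d l)"
    unfolding R_def geg_op_add geg_op_smult op by simp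
  have E2: "zonal_inner x y (smult k (geg d (Suc l))) (smult k (geg d (Suc l))) = k\<^sup>2 * E (Suc l)"
    by (simp add: zonal_inner_smult zonal_inner_commute[of x y _ "smult _ _"]
        zonal_inner_commute[of y x] E_def power2_eq_square del: geg.simps(2))
  have comb: "zonal_inner x y (smult a (geg d (Suc (Suc l))) + smult b (geg d l)) (smult a' (geg d (Suc (Suc l))) + smult b' (geg d l))
      = a * a' * E (Suc (Suc l)) + b * b' * E l" for a b a' b'
    unfolding E_def by (rule zonal_inner_geg_lincomb[OF d x y]) simp
  have "\<alpha> * \<mu> (l + 2) * \<alpha> * E (Suc (Suc l)) + \<beta> * \<mu> l * \<beta> * E l
      = ((real l + real d) * (real l + real d) * E (Suc (Suc l)) + (real l + 1) * (real l + 1) * E l) - (x \<bullet> y) * (k\<^sup>2 * E (Suc l))"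
    using zonal_inner_geg_op[OF x, of y R R] unfolding DR XR' unfolding R' E2 unfolding R_def comb .
  then have *: "(x \<bullet> y) * k\<^sup>2 * E (Suc l) = ((real l + real d)\<^sup>2 - \<alpha>\<^sup>2 * \<mu> (l + 2)) * E (Suc (Suc l))
      + ((real l + 1)\<^sup>2 - \<beta>\<^sup>2 * \<mu> l) * E l"
    by (simp add: algebra_simps power2_eq_square)
  have 1: "(real l + real d)\<^sup>2 - \<alpha>\<^sup>2 * \<mu> (l + 2) = (real l + real d)\<^sup>2 * (2 * real l + real d + 3) / (real l + 2)"
  proof -
    \<comment> \<open>Here u = l + d and v = l + 2, so that \<alpha> = u / v and the eigenvalue of
      degree l + 2 is -v (u + 1).\<close>
    have "u\<^sup>2 - (u / v)\<^sup>2 * - (v * (u + 1)) = u\<^sup>2 * (u + v + 1) / v" if "v > 0" for u v :: real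
      using that by (simp add: field_simps power2_eq_square)
    from this[of "real l + 2" "real l + real d"] show ?thesis
      by (simp add: \<alpha>_def \<mu>_def algebra_simps)
  qed
  have 2: "(real l + 1)\<^sup>2 - \<beta>\<^sup>2 * \<mu> l = (real l + 1)\<^sup>2 * (2 * real l + real d - 1) / (real l + real d - 1)"
  proof -
    \<comment> \<open>Here u = l + 1 and v = l + d - 1, so that \<beta> = -u / v and the eigenvalue
      of degree l is -(u - 1) v.\<close>
    have "u\<^sup>2 - (- (u / v))\<^sup>2 * - ((u - 1) * v) = u\<^sup>2 * (u + v - 1) / v" if "v > 0" for u v :: real
      using that by (simp add: field_simps power2_eq_square)
    from this[of "real l + real d - 1" "real l + 1"] d(1) show ?thesis
      by (simp add: \<beta>_def \<mu>_def algebra_simps)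
  qed
  show ?thesis
    using * unfolding 1 2 k_def .
qed

text \<open>Both sides satisfy the same three-term recurrence in \<open>l\<close> and agree for
  degrees 0 and 1.\<close>

lemma zonal_inner_geg:
  fixes x y :: "real ^ 'n"
  assumes d: "d \<ge> 2" "CARD('n) = d + 1" and x: "norm x = 1" and y: "norm y = 1"
  shows "Zdim d l * zonal_inner x y (geg d l) (geg d l) = poly (geg d l) (x \<bullet> y)"
proof (induction l rule: induct_nat_012)
  case 0
  have "measure \<sigma>\<^sub>S (space \<sigma>\<^sub>S :: (real ^ 'n) set) = 1"
    by (simp add: measure_def emeasure_sphere_measure_sphere)
  then show ?case
    using d by (simp add: zonal_inner_def Zdim_0)
next
  case 1
  have "measure \<sigma>\<^sub>S (space \<sigma>\<^sub>S :: (real ^ 'n) set) = 1"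
    by (simp add: measure_def emeasure_sphere_measure_sphere)
  then have E0: "zonal_inner x y 1 1 = 1"
    by (simp add: zonal_inner_def)
  have geg1: "geg d (Suc 0) = [:0, 1:]"
    by simp
  have dX: "pderiv [:0, 1:] = (1 :: real poly)"
    by (simp add: pderiv_pCons)
  \<comment> \<open>For the diagonal integral E of degree 1, integration by parts with p = q = t
    gives -d E = E - x . y.\<close>
  have "geg_op (real CARD('n) - 1) [:0, 1:] = smult (- real d) [:0, 1:]"
    using geg_op_geg[OF d(1), of "Suc 0"] d(2) unfolding geg1 by simp
  then have "- real d * zonal_inner x y [:0, 1:] [:0, 1:] = zonal_inner x y [:0, 1:] [:0, 1:] - x \<bullet> y"
    using zonal_inner_geg_op[OF x, of y "[:0, 1:]" "[:0, 1:]"] unfolding dX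
    by (simp only: zonal_inner_smult E0 mult_1_right)
  then have "(real d + 1) * zonal_inner x y [:0, 1:] [:0, 1:] = x \<bullet> y"
    by (simp add: algebra_simps)
  moreover have "Zdim d (Suc 0) = real d + 1"
    using Zdim_Suc[OF d(1), of 0] d(1) by (simp add: Zdim_0)
  ultimately show ?case
    unfolding geg1 by simp
next
  case (ge2 l)
  define E where "E l = zonal_inner x y (geg d l) (geg d l)" for l
  define P where "P l = poly (geg d l) (x \<bullet> y)" for l
  define Z where "Z = Zdim d"
  define k where "k = 2 * real l + real d + 1"
  have pos: "Z l > 0" "Z (Suc l) > 0" "Z (Suc (Suc l)) > 0"
    using d by (simp_all add: Z_def Zdim_pos)
  have dl: "real l + real d - 1 > 0" "2 * real l + real d - 1 > 0" "real l + real d > 0" "k > 0"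
    using d by (simp_all add: k_def)
  have IH: "E l = P l / Z l" "E (Suc l) = P (Suc l) / Z (Suc l)"
    using ge2 pos by (simp_all add: E_def P_def Z_def field_simps)
  have three: "k * ((x \<bullet> y) * P (Suc l)) = (real l + real d) * P (Suc (Suc l)) + (real l + 1) * P l"
    using arg_cong[OF geg_three_term[OF d(1), of l], where f = "\<lambda>p. poly p (x \<bullet> y)"]
    by (simp add: P_def k_def mult.left_commute del: geg.simps(2))
  have rec: "(x \<bullet> y) * k\<^sup>2 * E (Suc l)
    = (real l + real d)\<^sup>2 * (2 * real l + real d + 3) / (real l + 2) * E (Suc (Suc l))
      + (real l + 1)\<^sup>2 * (2 * real l + real d - 1) / (real l + real d - 1) * E l"
    using zonal_inner_geg_rec[OF d x y, of l] unfolding E_def k_def .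
  \<comment> \<open>\<open>Z1\<close> and \<open>Z2\<close> rewrite the coefficients of the
    recurrence as ratios of dimensions, which exposes the common factor
    \<open>k / Z (Suc l)\<close>.\<close>
  have Z1: "(2 * real l + real d - 1) / (real l + real d - 1) / Z l = k / ((real l + 1) * Z (Suc l))"
  proof -
    have "q / a / z = u / (b * z')" if "z' * (q * b) = z * (u * a)" "a > 0" "b > 0" "z > 0" "z' > 0"
      for q a z z' u b :: real
      using that by (simp add: field_simps)
    from this[OF Zdim_Suc[OF d(1), of l]] show ?thesis
      using pos dl by (simp add: Z_def k_def)
  qed
  have Z2: "(2 * real l + real d + 3) / (real l + 2) = k * Z (Suc (Suc l)) / ((real l + real d) * Z (Suc l))"
  proof -
    have *: "q / b = u * z' / (a * z)" if "z' * (u * b) = z * (q * a)" "a > 0" "b > 0" "z > 0"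
      for q a z z' u b :: real
      using that by (simp add: field_simps)
    have "Z (Suc (Suc l)) * (k * (real l + 2)) = Z (Suc l) * ((2 * real l + real d + 3) * (real l + real d))"
      using Zdim_Suc[OF d(1), of "Suc l"] by (simp add: Z_def k_def algebra_simps)
    from *[OF this] show ?thesis
      using pos dl by simp
  qed
  have "(real l + 1)\<^sup>2 * (2 * real l + real d - 1) / (real l + real d - 1) * E l
      = (real l + 1)\<^sup>2 * P l * ((2 * real l + real d - 1) / (real l + real d - 1) / Z l)"
    unfolding IH by simp
  also have "\<dots> = (real l + 1) * k * P l / Z (Suc l)"
    unfolding Z1 by (simp add: power2_eq_square)
  finally have b: "(real l + 1)\<^sup>2 * (2 * real l + real d - 1) / (real l + real d - 1) * E l
      = (real l + 1) * k * P l / Z (Suc l)" .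
  have "(real l + real d)\<^sup>2 * (2 * real l + real d + 3) / (real l + 2) * E (Suc (Suc l))
      = (real l + real d)\<^sup>2 * ((2 * real l + real d + 3) / (real l + 2)) * E (Suc (Suc l))"
    by simp
  also have "\<dots> = (real l + real d) * k * (Z (Suc (Suc l)) * E (Suc (Suc l))) / Z (Suc l)"
    unfolding Z2 using dl by (simp add: power2_eq_square)
  finally have a: "(real l + real d)\<^sup>2 * (2 * real l + real d + 3) / (real l + 2) * E (Suc (Suc l))
      = (real l + real d) * k * (Z (Suc (Suc l)) * E (Suc (Suc l))) / Z (Suc l)" .
  have "(x \<bullet> y) * k\<^sup>2 * E (Suc l) = (real l + real d) * k * (Z (Suc (Suc l)) * E (Suc (Suc l))) / Z (Suc l)
      + (real l + 1) * k * P l / Z (Suc l)"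
    unfolding rec a b ..
  \<comment> \<open>Without the common factor this is the three-term recurrence with
    \<open>Z (Suc (Suc l)) * E (Suc (Suc l))\<close> in the place of
    \<open>P (Suc (Suc l))\<close>.\<close>
  then have "k * (k * ((x \<bullet> y) * P (Suc l))) / Z (Suc l)
      = k * ((real l + real d) * (Z (Suc (Suc l)) * E (Suc (Suc l))) + (real l + 1) * P l) / Z (Suc l)"
    unfolding IH(2) by (simp add: power2_eq_square algebra_simps add_divide_distrib)
  then have "(real l + real d) * (Z (Suc (Suc l)) * E (Suc (Suc l))) = (real l + real d) * P (Suc (Suc l))"
    unfolding three using pos dl by simp
  then show ?case
    using dl by (simp add: E_def P_def Z_def)
qed

lemma zonal_inner_sum:
  "zonal_inner x y (\<Sum>l\<in>A. f l) q = (\<Sum>l\<in>A. zonal_inner x y (f l) q)"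
  by (induction A rule: infinite_finite_induct)
    (simp_all add: zonal_inner_add, simp_all add: zonal_inner_def)

text \<open>Only diagonal terms survive; there the two factors \<open>Zdim d l\<close> meet one
  reciprocal from the reproducing property.\<close>

lemma zonal_inner_geg_sum:
  fixes x y :: "real ^ 'n" and a :: "nat \<Rightarrow> real"
  assumes d: "d \<ge> 2" "CARD('n) = d + 1" and x: "norm x = 1" and y: "norm y = 1"
    and K: "K = (\<Sum>l<L. smult (a l * Zdim d l) (geg d l))"
  shows "zonal_inner x y K K = (\<Sum>l<L. (a l)\<^sup>2 * Zdim d l * poly (geg d l) (x \<bullet> y))"
proof -
  have *: "zonal_inner x y (geg d l) K = a l * poly (geg d l) (x \<bullet> y)" if "l < L" for l
  proof -
    have "zonal_inner x y (geg d l) K = (\<Sum>m<L. a m * Zdim d m * zonal_inner x y (geg d l) (geg d m))"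
      by (simp add: zonal_inner_commute[of x y] K zonal_inner_sum zonal_inner_smult)
    also have "\<dots> = (\<Sum>m<L. if m = l then a l * poly (geg d l) (x \<bullet> y) else 0)"
      using zonal_inner_geg[OF d x y] zonal_inner_geg_orthogonal[OF d x y]
      by (intro sum.cong refl) (auto simp: mult.assoc)
    finally show ?thesis
      using that by simp
  qed
  have "zonal_inner x y K K = (\<Sum>l<L. a l * Zdim d l * zonal_inner x y (geg d l) K)"
    by (subst (1) K) (simp add: zonal_inner_sum zonal_inner_smult)
  also have "\<dots> = (\<Sum>l<L. (a l)\<^sup>2 * Zdim d l * poly (geg d l) (x \<bullet> y))"
    by (intro sum.cong refl) (simp add: * power2_eq_square)
  finally show ?thesis .
qed

section \<open>Quadrature and filters\<close>

lemma poly_degree_le_monomial: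
  assumes "(\<Sum>i\<in>UNIV. e i) \<le> \<nu>"
  shows "poly_degree_le \<nu> (\<lambda>z :: real ^ 'n. \<Prod>i\<in>UNIV. (z $ i) ^ e i)"
  unfolding poly_degree_le_def
proof (intro exI allI)
  fix z :: "real ^ 'n"
  have "(\<Sum>a | (\<Sum>i\<in>UNIV. a i) \<le> \<nu>. (if a = e then 1 else 0) * (\<Prod>i\<in>UNIV. (z $ i) ^ a i))
      = (\<Sum>a | (\<Sum>i\<in>UNIV. a i) \<le> \<nu>. if a = e then \<Prod>i\<in>UNIV. (z $ i) ^ e i else 0)"
    by (intro sum.cong) auto
  then show "(\<Prod>i\<in>UNIV. (z $ i) ^ e i)
      = (\<Sum>a | (\<Sum>i\<in>UNIV. a i) \<le> \<nu>. (\<lambda>a. if a = e then 1 else 0) a * (\<Prod>i\<in>UNIV. (z $ i) ^ a i))"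
    using assms by (simp add: finite_multi_indices)
qed

lemma poly_degree_le_add:
  assumes "poly_degree_le \<nu> p" "poly_degree_le \<nu> q"
  shows "poly_degree_le \<nu> (\<lambda>z. p z + q z)"
proof -
  obtain c c' where "\<forall>x. p x = (\<Sum>a | (\<Sum>i\<in>UNIV. a i) \<le> \<nu>. c a * (\<Prod>i\<in>UNIV. (x $ i) ^ a i))"
    "\<forall>x. q x = (\<Sum>a | (\<Sum>i\<in>UNIV. a i) \<le> \<nu>. c' a * (\<Prod>i\<in>UNIV. (x $ i) ^ a i))"
    using assms unfolding poly_degree_le_def by blast
  then show ?thesis
    unfolding poly_degree_le_def
    by (intro exI[of _ "\<lambda>a. c a + c' a"]) (simp add: distrib_right sum.distrib)
qed

lemma poly_degree_le_cmult:
  assumes "poly_degree_le \<nu> p"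
  shows "poly_degree_le \<nu> (\<lambda>z. b * p z)"
proof -
  obtain c where "\<forall>x. p x = (\<Sum>a | (\<Sum>i\<in>UNIV. a i) \<le> \<nu>. c a * (\<Prod>i\<in>UNIV. (x $ i) ^ a i))"
    using assms unfolding poly_degree_le_def by blast
  then show ?thesis
    unfolding poly_degree_le_def
    by (intro exI[of _ "\<lambda>a. b * c a"]) (simp add: sum_distrib_left mult.assoc)
qed

lemma poly_degree_le_const: "poly_degree_le \<nu> (\<lambda>_. b)"
  using poly_degree_le_cmult[OF poly_degree_le_monomial[of "\<lambda>_. 0" \<nu>], of b] by simp

lemma poly_degree_le_sum:
  assumes "\<And>a. a \<in> A \<Longrightarrow> poly_degree_le \<nu> (f a)"
  shows "poly_degree_le \<nu> (\<lambda>z. \<Sum>a\<in>A. f a z)"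
  using assms by (induction A rule: infinite_finite_induct)
    (auto intro: poly_degree_le_const poly_degree_le_add)

lemma poly_degree_le_component: "poly_degree_le 1 (\<lambda>z :: real ^ 'n. z $ i)"
proof -
  have "(\<Prod>j\<in>UNIV. (z $ j) ^ (if j = i then 1 else 0)) = z $ i" for z :: "real ^ 'n"
    by (simp add: if_distrib[of "\<lambda>k. _ ^ k"] cong: if_cong)
  then show ?thesis
    using poly_degree_le_monomial[where e = "\<lambda>j. if j = i then 1 else 0" and \<nu> = 1] by simp
qed

lemma poly_degree_le_inner: "poly_degree_le 1 (\<lambda>z :: real ^ 'n. x \<bullet> z)"
  unfolding inner_vec_def inner_real_def
  by (intro poly_degree_le_sum poly_degree_le_cmult poly_degree_le_component)

text \<open>The product is written as a double sum over pairs of exponents, so that closure under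
  sums replaces collecting equal monomials.\<close>

lemma poly_degree_le_mult:
  assumes "poly_degree_le m p" "poly_degree_le n q"
  shows "poly_degree_le (m + n) (\<lambda>z. p z * q z)"
proof -
  obtain c c' where p: "\<And>x. p x = (\<Sum>a | (\<Sum>i\<in>UNIV. a i) \<le> m. c a * (\<Prod>i\<in>UNIV. (x $ i) ^ a i))"
    and q: "\<And>x. q x = (\<Sum>a | (\<Sum>i\<in>UNIV. a i) \<le> n. c' a * (\<Prod>i\<in>UNIV. (x $ i) ^ a i))"
    using assms unfolding poly_degree_le_def by blast
  have eq: "(\<lambda>z. p z * q z) = (\<lambda>z. \<Sum>a | (\<Sum>i\<in>UNIV. a i) \<le> m. \<Sum>b | (\<Sum>i\<in>UNIV. b i) \<le> n.
      (c a * c' b) * (\<Prod>i\<in>UNIV. (z $ i) ^ (a i + b i)))"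
    unfolding p q sum_product power_add prod.distrib by (simp only: mult_ac)
  show ?thesis
    unfolding eq
    by (intro poly_degree_le_sum poly_degree_le_cmult poly_degree_le_monomial)
      (simp add: sum.distrib add_mono)
qed

text \<open>Multiplies by the constant 1, regarded as a polynomial of degree at most
  \<open>n - m\<close>.\<close>

lemma poly_degree_le_mono:
  assumes "poly_degree_le m p" "m \<le> n"
  shows "poly_degree_le n p"
  using poly_degree_le_mult[OF assms(1) poly_degree_le_const[of "n - m" 1]] assms(2) by simp

lemma poly_degree_le_power:
  assumes "poly_degree_le m p"
  shows "poly_degree_le (k * m) (\<lambda>z. p z ^ k)"
proof (induction k)
  case (Suc k)
  then show ?case
    using poly_degree_le_mult[OF assms Suc] by simp
qed (simp add: poly_degree_le_const)

lemma poly_degree_le_poly_inner: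
  assumes "degree p \<le> n"
  shows "poly_degree_le n (\<lambda>z. poly p (x \<bullet> z))"
  unfolding poly_altdef
proof (intro poly_degree_le_sum poly_degree_le_cmult)
  fix k assume "k \<in> {..degree p}"
  then show "poly_degree_le n (\<lambda>z. (x \<bullet> z) ^ k)"
    using poly_degree_le_mono[OF poly_degree_le_power[OF poly_degree_le_inner, of k x]] assms by simp
qed

section \<open>Kernels as finite sums, and the filters\<close>

lemma filtered_kernel_eq_sum:
  assumes "d \<ge> 2" "j \<ge> 1" "\<And>t. t \<ge> 2 \<Longrightarrow> g t = 0"
  shows "filtered_kernel d (2 powr (real j - 1)) g t
    = (\<Sum>l<2^j. g (real l / 2 ^ (j - 1)) * Zdim d l * poly (geg d l) t)"
proof -
  have T: "2 powr (real j - 1) = (2 :: real) ^ (j - 1)"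
    using assms(2) by (simp add: powr_realpow[symmetric] of_nat_diff)
  have j: "(2 :: nat) ^ j = 2 * 2 ^ (j - 1)"
    using assms(2) by (cases j) auto
  \<comment> \<open>From \<open>l = 2 ^ j\<close> on the argument is at least 2. The filter vanishes
    at 2 itself as well, so the kernel has degree at most 2^j - 1.\<close>
  have "g (real l / 2 ^ (j - 1)) = 0" if "l \<notin> {..<2 ^ j}" for l
  proof (rule assms(3))
    have "real (2 * 2 ^ (j - 1)) \<le> real l"
      using that j by (simp only: of_nat_le_iff lessThan_iff not_less)
    then show "2 \<le> real l / 2 ^ (j - 1)"
      by (simp add: pos_le_divide_eq)
  qed
  then have "(\<Sum>l. g (real l / 2 ^ (j - 1)) * Zdim d l * gegenbauer_P d l t)
      = (\<Sum>l<2^j. g (real l / 2 ^ (j - 1)) * Zdim d l * gegenbauer_P d l t)"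
    by (intro suminf_finite) auto
  moreover have "\<not> (2 :: real) ^ (j - 1) < 1"
    by (simp add: not_less)
  ultimately show ?thesis
    unfolding filtered_kernel_def T by (simp add: gegenbauer_P_eq_geg[OF assms(1)])
qed

text \<open>Outside [1/2, 2] this is the support condition. The endpoint 2 belongs to the support,
  and there the value 0 follows by continuity from the right.\<close>

lemma needlet_filter_zero:
  assumes "needlet_filter h" "t \<ge> 0" "t < 1 / 2 \<or> t \<ge> 2"
  shows "h t = 0"
proof -
  have supp: "closure {t. t \<ge> 0 \<and> h t \<noteq> 0} = {1/2..2}"
    using assms(1) by (simp add: needlet_filter_def)
  have out: "h u = 0" if "u \<ge> 0" "u \<notin> {1/2..2}" for u
    using that closure_subset[of "{t. t \<ge> 0 \<and> h t \<noteq> 0}"] unfolding supp by blast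
  obtain \<kappa> where \<kappa>: "\<kappa> \<ge> 1" "C_k_on \<kappa> h {0..}"
    using assms(1) by (auto simp: needlet_filter_def)
  then obtain f' where "\<And>t. t \<in> {0..} \<Longrightarrow> (h has_real_derivative f' t) (at t within {0..})"
    by (cases \<kappa>) auto
  then have "continuous_on {0..} h"
    by (rule DERIV_continuous_on)
  then have "closed {t \<in> {0..}. h t = 0}"
    by (intro continuous_closed_preimage_constant) auto
  moreover have "{2<..} \<subseteq> {t \<in> {0..}. h t = 0}"
    using out by auto
  ultimately have "closure {2<..} \<subseteq> {t \<in> {0..}. h t = 0}"
    by (rule closure_minimal[rotated])
  then have "h 2 = 0"
    by auto
  then show ?thesis
    using out[of t] assms(2,3) by (cases "t = 2") auto
qed

text \<open>The partition of unity \<open>h(t)\<^sup>2 + h(2t)\<^sup>2 = 1\<close> telescopes over dyadic scales.\<close>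

lemma needlet_filter_sum:
  assumes h: "needlet_filter h" and "l \<ge> 1" and "J \<ge> 1"
  shows "(\<Sum>j=1..J. (h (real l / 2 ^ (j - 1)))\<^sup>2) = hyper_filter h (real l / 2 ^ (J - 1))"
  using \<open>J \<ge> 1\<close>
proof (induction J rule: dec_induct)
  \<comment> \<open>Since \<open>l \<ge> 1\<close>, the argument lies where
    \<open>hyper_filter h\<close> is the square of \<open>h\<close>; at \<open>l = 0\<close> the two
    sides would differ.\<close>
  case base
  then show ?case
    using \<open>l \<ge> 1\<close> by (simp add: hyper_filter_def)
next
  case (step J)
  define u where "u = real l / 2 ^ J"
  have u: "u \<ge> 0" "real l / 2 ^ (J - 1) = 2 * u"
    using step.hyps by (simp_all add: u_def power_diff)
  have "(\<Sum>j=1..Suc J. (h (real l / 2 ^ (j - 1)))\<^sup>2) = hyper_filter h (2 * u) + (h u)\<^sup>2"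
    using step u(2) by (simp add: u_def)
  also have "\<dots> = hyper_filter h u"
  proof -
    \<comment> \<open>In the first case \<open>h u\<close> is 0 and both values of
      \<open>hyper_filter\<close> are 1, in the second the partition of unity applies, and in the
      third \<open>h (2 * u)\<close> is 0.\<close>
    consider "u < 1/2" | "1/2 \<le> u" "u < 1" | "u \<ge> 1"
      by linarith
    then show ?thesis
    proof cases
      case 2
      then show ?thesis
        using h by (auto simp: hyper_filter_def needlet_filter_def add.commute)
    qed (use u(1) needlet_filter_zero[OF h] in \<open>auto simp: hyper_filter_def\<close>)
  qed
  finally show ?case
    by (simp add: u_def)
qed

section \<open>Needlet products and the hyperinterpolation kernel\<close>

lemma degree_geg_sum: "degree (\<Sum>l<Suc L. smult (a l) (geg d l)) \<le> L"
  by (intro degree_sum_le order_trans[OF degree_smult_le] order_trans[OF degree_geg]) auto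

text \<open>The two square roots combine to the quadrature weight, so the sum is a quadrature of a
  product of two zonal polynomials, within the range of exactness. The resulting integral is
  evaluated by the reproducing property.\<close>

lemma sum_needlet_products:
  fixes x y :: "real ^ 'n"
  assumes d: "d \<ge> 2" "CARD('n) = d + 1" and x: "norm x = 1" and y: "norm y = 1"
    and h: "needlet_filter h"
    and w: "positive_quadrature (Nn j) (w j) (xi j)"
    and ex: "quadrature_exact (2 ^ (j + 1) - 1) (Nn j) (w j) (xi j)"
  shows "(\<Sum>k=1..Nn j. needlet d h w xi j k y * needlet d h w xi j k x)
    = (if j = 0 then 1 else \<Sum>l<2^j. (h (real l / 2 ^ (j - 1)))\<^sup>2 * Zdim d l * poly (geg d l) (y \<bullet> x))"
proof -
  \<comment> \<open>At level 0 the scale is 1/2, below 1, where the kernel is the constant 1 by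
    convention.\<close>
  define K where "K = (if j = 0 then 1 else \<Sum>l<2^j. smult (h (real l / 2 ^ (j - 1)) * Zdim d l) (geg d l))"
  have K: "filtered_kernel d (2 powr (real j - 1)) h t = poly K t" for t
    using filtered_kernel_eq_sum[OF d(1), of j h t] needlet_filter_zero[OF h]
    by (cases "j = 0") (auto simp: K_def filtered_kernel_def poly_sum powr_minus)
  have "degree K \<le> 2 ^ j - 1"
    using degree_geg_sum[of "\<lambda>l. h (real l / 2 ^ (j - 1)) * Zdim d l" d "2 ^ j - 1"] by (simp add: K_def)
  then have "poly_degree_le (2 ^ (j + 1) - 1) (\<lambda>z. poly K (y \<bullet> z) * poly K (x \<bullet> z))"
    by (intro poly_degree_le_mono[OF poly_degree_le_mult[OF poly_degree_le_poly_inner poly_degree_le_poly_inner]]) auto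
  then have int: "zonal_inner y x K K = (\<Sum>k=1..Nn j. w j k * (poly K (y \<bullet> xi j k) * poly K (x \<bullet> xi j k)))"
    using ex by (simp add: quadrature_exact_def zonal_inner_def)
  have "(\<Sum>k=1..Nn j. needlet d h w xi j k y * needlet d h w xi j k x)
      = (\<Sum>k=1..Nn j. (sqrt (w j k) * sqrt (w j k)) * (poly K (y \<bullet> xi j k) * poly K (x \<bullet> xi j k)))"
    unfolding needlet_def K by (simp only: mult_ac)
  also have "\<dots> = zonal_inner y x K K"
  proof -
    have "sqrt (w j k) * sqrt (w j k) = w j k" if "k \<in> {1..Nn j}" for k
      using w that by (simp add: positive_quadrature_def less_imp_le)
    then show ?thesis
      unfolding int by (intro sum.cong refl) (simp only:)
  qed
  also have "\<dots> = (if j = 0 then 1 else \<Sum>l<2^j. (h (real l / 2 ^ (j - 1)))\<^sup>2 * Zdim d l * poly (geg d l) (y \<bullet> x))"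
  proof (cases "j = 0")
    case True
    then show ?thesis
      using zonal_inner_geg[OF d y x, of 0] d(1) by (simp add: K_def Zdim_0)
  next
    case False
    then show ?thesis
      using zonal_inner_geg_sum[OF d y x, where K = K and L = "2 ^ j" and a = "\<lambda>l. h (real l / 2 ^ (j - 1))"] by (simp add: K_def)
  qed
  finally show ?thesis .
qed

text \<open>The constant of level 0 is the term \<open>l = 0\<close>, where
  \<open>hyper_filter h\<close> is 1 while \<open>h\<close> vanishes. For each larger degree the
  squares of \<open>h\<close> over the levels 1 to \<open>J\<close> add up to
  \<open>hyper_filter h\<close>.\<close>

lemma filtered_kernel_hyper_filter:
  assumes d: "d \<ge> 2" and h: "needlet_filter h"
  shows "filtered_kernel d (2 powr (real J - 1)) (hyper_filter h) t
    = (\<Sum>j=0..J. if j = 0 then 1 else \<Sum>l<2^j. (h (real l / 2 ^ (j - 1)))\<^sup>2 * Zdim d l * poly (geg d l) t)"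
proof (cases "J = 0")
  case True
  then show ?thesis
    by (simp add: filtered_kernel_def powr_minus)
next
  case False
  define c where "c l = Zdim d l * poly (geg d l) t" for l
  \<comment> \<open>Gives all levels the same range of degrees, so that the two sums can be
    exchanged: \<open>h\<close> vanishes at 0 and for degrees from \<open>2 ^ j\<close> on.\<close>
  have ext: "(\<Sum>l<2^j. (h (real l / 2 ^ (j - 1)))\<^sup>2 * c l) = (\<Sum>l\<in>{1..<2^J}. (h (real l / 2 ^ (j - 1)))\<^sup>2 * c l)"
    if "j \<in> {1..J}" for j
  proof (rule sum.mono_neutral_cong)
    have pow: "(2 :: nat) ^ j \<le> 2 ^ J" "(2 :: nat) ^ j = 2 * 2 ^ (j - 1)"
      using that by (auto simp: power_increasing) (cases j; simp)
    have "h (real l / 2 ^ (j - 1)) = 0" if "l \<ge> 2 ^ j" for l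
    proof (rule needlet_filter_zero[OF h])
      have "real (2 * 2 ^ (j - 1)) \<le> real l"
        using that pow(2) by (simp only: of_nat_le_iff)
      then show "real l / 2 ^ (j - 1) < 1 / 2 \<or> real l / 2 ^ (j - 1) \<ge> 2"
        by (simp add: pos_le_divide_eq)
    qed auto
    then show "(h (real l / 2 ^ (j - 1)))\<^sup>2 * c l = 0" if "l \<in> {1..<2 ^ J} - {..<2 ^ j}" for l
      using that by simp
    have "h 0 = 0"
      by (rule needlet_filter_zero[OF h]) auto
    then show "(h (real l / 2 ^ (j - 1)))\<^sup>2 * c l = 0" if "l \<in> {..<2 ^ j} - {1..<2 ^ J}" for l
      using that less_le_trans[OF _ pow(1), of l] by (cases "l = 0") auto
  qed auto
  have "(\<Sum>j=0..J. if j = 0 then 1 else \<Sum>l<2^j. (h (real l / 2 ^ (j - 1)))\<^sup>2 * c l)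
      = 1 + (\<Sum>j=1..J. \<Sum>l<2^j. (h (real l / 2 ^ (j - 1)))\<^sup>2 * c l)"
  proof -
    have "{0..J} = insert 0 {1..J}"
      by auto
    then show ?thesis
      by (auto intro!: sum.cong)
  qed
  also have "(\<Sum>j=1..J. \<Sum>l<2^j. (h (real l / 2 ^ (j - 1)))\<^sup>2 * c l)
      = (\<Sum>j=1..J. \<Sum>l\<in>{1..<2^J}. (h (real l / 2 ^ (j - 1)))\<^sup>2 * c l)"
    by (intro sum.cong refl ext)
  also have "\<dots> = (\<Sum>l\<in>{1..<2^J}. \<Sum>j=1..J. (h (real l / 2 ^ (j - 1)))\<^sup>2 * c l)"
    by (rule sum.swap)
  also have "\<dots> = (\<Sum>l\<in>{1..<2^J}. hyper_filter h (real l / 2 ^ (J - 1)) * c l)"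
    unfolding sum_distrib_right[symmetric]
    by (intro sum.cong refl arg_cong2[where f = "(*)"] needlet_filter_sum[OF h]) (use False in auto)
  also have "1 + \<dots> = (\<Sum>l<2^J. hyper_filter h (real l / 2 ^ (J - 1)) * c l)"
  proof -
    have "{..<2 ^ J :: nat} = insert 0 {1..<2 ^ J}"
      by auto
    then show ?thesis
      using d by (simp add: hyper_filter_def c_def Zdim_0)
  qed
  also have "\<dots> = filtered_kernel d (2 powr (real J - 1)) (hyper_filter h) t"
    using filtered_kernel_eq_sum[OF d, of J "hyper_filter h" t] False needlet_filter_zero[OF h]
    by (simp add: hyper_filter_def c_def mult.assoc)
  finally show ?thesis
    unfolding c_def mult.assoc by (rule sym)
qed

section \<open>Equality of the two approximations\<close>

theorem theorem4p1:
  fixes d :: nat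
    and h :: "real \<Rightarrow> real"
    and Nn :: "nat \<Rightarrow> nat" and w :: "nat \<Rightarrow> nat \<Rightarrow> real" and xi :: "nat \<Rightarrow> nat \<Rightarrow> real ^ 'n"
    and \<nu> N :: nat and W :: "nat \<Rightarrow> real" and y :: "nat \<Rightarrow> real ^ 'n"
    and f :: "real ^ 'n \<Rightarrow> real"
    and J :: nat
  assumes "d \<ge> 2" and "CARD('n) = d + 1"
    and "needlet_filter h"
    and "\<And>j. positive_quadrature (Nn j) (w j) (xi j)"
    and "\<And>j. quadrature_exact (2 ^ (j + 1) - 1) (Nn j) (w j) (xi j)"
    and "positive_quadrature N W y" and "quadrature_exact \<nu> N W y"
    and "continuous_on (sphere 0 1) f"
  shows "\<forall>x\<in>sphere 0 1.
           filtered_hyperinterpolation d (2 powr (real J - 1)) (hyper_filter h) N W y f x =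
             (\<Sum>j=0..J. \<Sum>k=1..Nn j.
                discrete_inner N W y f (needlet d h w xi j k) * needlet d h w xi j k x) \<and>
           (\<Sum>j=0..J. \<Sum>k=1..Nn j.
              discrete_inner N W y f (needlet d h w xi j k) * needlet d h w xi j k x) =
             discrete_needlet_approx d h Nn w xi J N W y f x"
proof (intro ballI conjI)
  fix x :: "real ^ 'n"
  assume "x \<in> sphere 0 1"
  then have x: "norm x = 1"
    by simp
  let ?\<psi> = "needlet d h w xi"
  have ker: "filtered_kernel d (2 powr (real J - 1)) (hyper_filter h) (y i \<bullet> x)
      = (\<Sum>j=0..J. \<Sum>k=1..Nn j. ?\<psi> j k (y i) * ?\<psi> j k x)" if "i \<in> {1..N}" for i
  proof -
    have "norm (y i) = 1"
      using assms(6) that by (simp add: positive_quadrature_def)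
    then have "(\<Sum>k=1..Nn j. ?\<psi> j k (y i) * ?\<psi> j k x)
        = (if j = 0 then 1 else \<Sum>l<2^j. (h (real l / 2 ^ (j - 1)))\<^sup>2 * Zdim d l * poly (geg d l) (y i \<bullet> x))" for j
      by (intro sum_needlet_products assms x)
    then show ?thesis
      by (simp only: filtered_kernel_hyper_filter[OF assms(1,3)])
  qed
  have "filtered_hyperinterpolation d (2 powr (real J - 1)) (hyper_filter h) N W y f x
      = (\<Sum>i=1..N. \<Sum>j=0..J. \<Sum>k=1..Nn j. W i * f (y i) * ?\<psi> j k (y i) * ?\<psi> j k x)"
    unfolding filtered_hyperinterpolation_def
    by (intro sum.cong refl) (simp add: ker sum_distrib_left mult.assoc)
  \<comment> \<open>The sum over the nodes \<open>y i\<close> moves innermost, where it forms the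
    discrete inner product.\<close>
  also have "\<dots> = (\<Sum>j=0..J. \<Sum>k=1..Nn j. \<Sum>i=1..N. W i * f (y i) * ?\<psi> j k (y i) * ?\<psi> j k x)"
    by (rule trans[OF sum.swap], rule sum.cong[OF refl], rule sum.swap)
  also have "\<dots> = (\<Sum>j=0..J. \<Sum>k=1..Nn j. discrete_inner N W y f (?\<psi> j k) * ?\<psi> j k x)"
    by (simp add: discrete_inner_def sum_distrib_right)
  finally show "filtered_hyperinterpolation d (2 powr (real J - 1)) (hyper_filter h) N W y f x
      = (\<Sum>j=0..J. \<Sum>k=1..Nn j. discrete_inner N W y f (?\<psi> j k) * ?\<psi> j k x)" .
qed (simp add: discrete_needlet_approx_def)

end
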